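(* Let $a,b,q$ be real constants, let $f=f(x^3,x^4)$ be a nowhere vanishing smooth function, and let $M$ be a connected open region of coordinates $(t,r,x^3,x^4)$ with $r\neq0$, equipped with the Robinson-Trautman metric $$ds^2=-2(a-2br-qr^{-1})\,dt^2+2\,dt\,dr-\frac{r^2}{f^2}\left[(dx^3)^2+(dx^4)^2\right].$$ Then its energy-momentum tensor $$T=\frac{c^4}{8\pi G}\left[S-\left(\frac{\kappa}{2}-\Lambda\right)g\right]$$ is of pseudosymmetric type, namely $$R\cdot T=\frac{q-2br^2}{r^3}\,Q(g,T).$$
   Context: $\nabla$ is the Levi-Civita connection of $g$; $c>0$, $G>0$ (speed of light, gravitational constant) and $\Lambda\in\mathbb R$ (cosmological constant) are constants. Sign convention: $\mathcal R(X,Y)Z=\nabla_Y\nabla_XZ-\nabla_X\nabla_YZ+\nabla_{[X,Y]}Z$, $R(X_1,X_2,X_3,X_4)=g(\mathcal R(X_1,X_2)X_3,X_4)$, $S_{jk}=g^{il}R_{ijkl}$ (Ricci tensor), $\kappa=g^{jk}S_{jk}$ (scalar curvature). With coordinates numbered $(t,r,x^3,x^4)=(x^1,x^2,x^3,x^4)$ and $F=f_3^2+f_4^2-f(f_{33}+f_{44})$ (subscripts denoting partial derivatives in $x^3,x^4$), this gives for this metric $R_{1212}=-\frac{2q}{r^3}$, $S_{12}=-\frac{4b}{r}$, $S_{33}=S_{44}=-\frac{2a-8br-F}{f^2}$, $\kappa=-\frac{2(-2a+12br+F)}{r^2}$. For a $(0,2)$-tensor $H$: $(R\cdot H)(X_1,X_2,X,Y)=-H(\mathcal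 R(X,Y)X_1,X_2)-H(X_1,\mathcal R(X,Y)X_2)$, and $Q(g,H)(X_1,X_2,X,Y)=g(X,X_1)H(Y,X_2)+g(X,X_2)H(X_1,Y)-g(Y,X_1)H(X,X_2)-g(Y,X_2)H(X_1,X)$. *)

theory Defs
  imports "HOL-Analysis.Analysis"
begin

definition pderiv_at :: "'n::finite \<Rightarrow> (real^'n \<Rightarrow> real) \<Rightarrow> real^'n \<Rightarrow> real" where
  "pderiv_at i \<phi> x = deriv (\<lambda>h. \<phi> (x + h *\<^sub>R axis i 1)) 0"

primrec Ck_on :: "nat \<Rightarrow> (real^'n::finite) set \<Rightarrow> (real^'n \<Rightarrow> real) \<Rightarrow> bool" where
  "Ck_on 0 U \<phi> \<longleftrightarrow> continuous_on U \<phi>"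
| "Ck_on (Suc k) U \<phi> \<longleftrightarrow> \<phi> differentiable_on U \<and> (\<forall>i. Ck_on k U (pderiv_at i \<phi>))"

text \<open>Smoothness is only meant for open \<open>U\<close>; values outside \<open>U\<close> are irrelevant.\<close>

definition smooth_fun :: "(real^'n::finite) set \<Rightarrow> (real^'n \<Rightarrow> real) \<Rightarrow> bool" where
  "smooth_fun U \<phi> \<longleftrightarrow> (\<forall>k. Ck_on k U \<phi>)"

type_synonym 'n vfield = "real^'n \<Rightarrow> real^'n"

definition smooth_vfield :: "(real^'n::finite) set \<Rightarrow> 'n vfield \<Rightarrow> bool" where
  "smooth_vfield U X \<longleftrightarrow> (\<forall>i. smooth_fun U (\<lambda>x. X x $ i))"

definition coord_vfield :: "'n::finite \<Rightarrow> 'n vfield" where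
  "coord_vfield i = (\<lambda>x. axis i 1)"

definition vfield_apply :: "'n::finite vfield \<Rightarrow> (real^'n \<Rightarrow> real) \<Rightarrow> real^'n \<Rightarrow> real" where
  "vfield_apply X \<phi> x = (\<Sum>i\<in>UNIV. X x $ i * pderiv_at i \<phi> x)"

definition lie_bracket :: "'n::finite vfield \<Rightarrow> 'n vfield \<Rightarrow> 'n vfield" where
  "lie_bracket X Y x =
     (\<chi> k. vfield_apply X (\<lambda>y. Y y $ k) x - vfield_apply Y (\<lambda>y. X y $ k) x)"

text \<open>A \<open>(0,2)\<close>-tensor field is given by the matrix field of its components in the coordinates.\<close>

type_synonym 'n tensor02 = "real^'n \<Rightarrow> real^'n^'n"

definition eval02 :: "'n::finite tensor02 \<Rightarrow> 'n vfield \<Rightarrow> 'n vfield \<Rightarrow> real^'n \<Rightarrow> real" where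
  "eval02 H X Y x = (\<Sum>i\<in>UNIV. \<Sum>j\<in>UNIV. H x $ i $ j * X x $ i * Y x $ j)"

type_synonym 'n connection = "'n vfield \<Rightarrow> 'n vfield \<Rightarrow> 'n vfield"

text \<open>\<open>D X Y\<close> is the covariant derivative of \<open>Y\<close> along \<open>X\<close>.\<close>

definition affine_connection :: "(real^'n::finite) set \<Rightarrow> 'n connection \<Rightarrow> bool" where
  "affine_connection U D \<longleftrightarrow>
     (\<forall>X Y. smooth_vfield U X \<longrightarrow> smooth_vfield U Y \<longrightarrow> smooth_vfield U (D X Y)) \<and>
     (\<forall>X Y Z. smooth_vfield U X \<longrightarrow> smooth_vfield U Y \<longrightarrow> smooth_vfield U Z \<longrightarrow>
        (\<forall>x\<in>U. D (\<lambda>y. X y + Y y) Z x = D X Z x + D Y Z x \<and>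
               D Z (\<lambda>y. X y + Y y) x = D Z X x + D Z Y x)) \<and>
     (\<forall>\<phi> X Y. smooth_fun U \<phi> \<longrightarrow> smooth_vfield U X \<longrightarrow> smooth_vfield U Y \<longrightarrow>
        (\<forall>x\<in>U. D (\<lambda>y. \<phi> y *\<^sub>R X y) Y x = \<phi> x *\<^sub>R D X Y x \<and>
               D X (\<lambda>y. \<phi> y *\<^sub>R Y y) x = vfield_apply X \<phi> x *\<^sub>R Y x + \<phi> x *\<^sub>R D X Y x))"

definition torsion_free :: "(real^'n::finite) set \<Rightarrow> 'n connection \<Rightarrow> bool" where
  "torsion_free U D \<longleftrightarrow>
     (\<forall>X Y. smooth_vfield U X \<longrightarrow> smooth_vfield U Y \<longrightarrow>
        (\<forall>x\<in>U. D X Y x - D Y X x = lie_bracket X Y x))"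

definition metric_compatible ::
  "(real^'n::finite) set \<Rightarrow> 'n tensor02 \<Rightarrow> 'n connection \<Rightarrow> bool" where
  "metric_compatible U g D \<longleftrightarrow>
     (\<forall>X Y Z. smooth_vfield U X \<longrightarrow> smooth_vfield U Y \<longrightarrow> smooth_vfield U Z \<longrightarrow>
        (\<forall>x\<in>U. vfield_apply X (eval02 g Y Z) x = eval02 g (D X Y) Z x + eval02 g Y (D X Z) x))"

definition levi_civita :: "(real^'n::finite) set \<Rightarrow> 'n tensor02 \<Rightarrow> 'n connection \<Rightarrow> bool" where
  "levi_civita U g D \<longleftrightarrow>
     affine_connection U D \<and> torsion_free U D \<and> metric_compatible U g D"

text \<open>Beware of the sign: this is the negative of the curvature operator
  \<open>[D X, D Y] - D [X, Y]\<close> of many textbooks.\<close>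

definition curvature_op ::
  "'n::finite connection \<Rightarrow> 'n vfield \<Rightarrow> 'n vfield \<Rightarrow> 'n vfield \<Rightarrow> 'n vfield" where
  "curvature_op D X Y Z x = D Y (D X Z) x - D X (D Y Z) x + D (lie_bracket X Y) Z x"

definition riemann ::
  "'n::finite tensor02 \<Rightarrow> 'n connection \<Rightarrow>
   'n vfield \<Rightarrow> 'n vfield \<Rightarrow> 'n vfield \<Rightarrow> 'n vfield \<Rightarrow> real^'n \<Rightarrow> real" where
  "riemann g D X1 X2 X3 X4 = eval02 g (curvature_op D X1 X2 X3) X4"

definition ricci :: "'n::finite tensor02 \<Rightarrow> 'n connection \<Rightarrow> 'n tensor02" where
  "ricci g D x =
     (\<chi> j k. \<Sum>i\<in>UNIV. \<Sum>l\<in>UNIV. matrix_inv (g x) $ i $ l *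
        riemann g D (coord_vfield i) (coord_vfield j) (coord_vfield k) (coord_vfield l) x)"

definition scalar_curvature :: "'n::finite tensor02 \<Rightarrow> 'n connection \<Rightarrow> real^'n \<Rightarrow> real" where
  "scalar_curvature g D x =
     (\<Sum>j\<in>UNIV. \<Sum>k\<in>UNIV. matrix_inv (g x) $ j $ k * ricci g D x $ j $ k)"

definition curvature_dot ::
  "'n::finite connection \<Rightarrow> 'n tensor02 \<Rightarrow>
   'n vfield \<Rightarrow> 'n vfield \<Rightarrow> 'n vfield \<Rightarrow> 'n vfield \<Rightarrow> real^'n \<Rightarrow> real" where
  "curvature_dot D H X1 X2 X Y x =
     - eval02 H (curvature_op D X Y X1) X2 x - eval02 H X1 (curvature_op D X Y X2) x"

definition tachibana ::
  "'n::finite tensor02 \<Rightarrow> 'n tensor02 \<Rightarrow>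
   'n vfield \<Rightarrow> 'n vfield \<Rightarrow> 'n vfield \<Rightarrow> 'n vfield \<Rightarrow> real^'n \<Rightarrow> real" where
  "tachibana g H X1 X2 X Y x =
     eval02 g X X1 x * eval02 H Y X2 x + eval02 g X X2 x * eval02 H X1 Y x
     - eval02 g Y X1 x * eval02 H X X2 x - eval02 g Y X2 x * eval02 H X1 X x"

definition energy_momentum ::
  "real \<Rightarrow> real \<Rightarrow> real \<Rightarrow> 'n::finite tensor02 \<Rightarrow> 'n connection \<Rightarrow> 'n tensor02" where
  "energy_momentum c G \<Lambda> g D x =
     (c ^ 4 / (8 * pi * G)) *\<^sub>R (ricci g D x - (scalar_curvature g D x / 2 - \<Lambda>) *\<^sub>R g x)"

definition x34 :: "real^4 \<Rightarrow> real^2" where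
  "x34 x = vector [x $ 3, x $ 4]"

text \<open>The coordinates are \<open>t = x $ 1\<close>, \<open>r = x $ 2\<close>, \<open>x $ 3\<close>, \<open>x $ 4\<close>; the summand
  \<open>2 dt dr\<close> of the line element contributes the entry \<open>1\<close> in the positions \<open>(1,2)\<close> and \<open>(2,1)\<close>.\<close>

definition robinson_trautman ::
  "real \<Rightarrow> real \<Rightarrow> real \<Rightarrow> (real^2 \<Rightarrow> real) \<Rightarrow> 4 tensor02" where
  "robinson_trautman a b q f x =
     (let r = x $ 2; w = f (x34 x) in
      vector [vector [- 2 * (a - 2 * b * r - q / r), 1, 0, 0],
              vector [1, 0, 0, 0],
              vector [0, 0, - (r\<^sup>2 / w\<^sup>2), 0],
              vector [0, 0, 0, - (r\<^sup>2 / w\<^sup>2)]])"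

end

theory Submission
  imports Defs
begin

text \<open>The metric is a warped product \<open>g = B + F\<close> of the \<open>(t, r)\<close>-plane and the
  \<open>(x\<^sup>3, x\<^sup>4)\<close>-plane with warping function \<open>r\<^sup>2\<close>. With \<open>h = a - 2 b r - q / r\<close>, the Christoffel symbols,
  which Koszul's formula determines, show that the curvature operator is
  \<open>R(X, Y) Z = (K B(X, Z) + L F(X, Z)) Y\<^sub>B - (K B(Y, Z) + L F(Y, Z)) X\<^sub>B
  + (L B(X, Z) + N F(X, Z)) Y\<^sub>F - (L B(Y, Z) + N F(Y, Z)) X\<^sub>F\<close> with \<open>K = - h''\<close> and \<open>L = - h' / r\<close>.
  Its traces are combinations of \<open>B\<close> and \<open>F\<close>, hence so is \<open>T = \<alpha> B + \<beta> F\<close>. In \<open>R \<sqdot> T\<close>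
  the terms with \<open>K\<close> and \<open>N\<close> cancel, and the mixed ones are \<open>- L Q(g, T)\<close>, whatever \<open>\<alpha>\<close> and \<open>\<beta>\<close> are.\<close>

subsection \<open>Partial derivatives and smooth functions\<close>

lemma has_field_derivative_pderiv_at:
  assumes "\<phi> differentiable (at x)"
  shows "((\<lambda>h. \<phi> (x + h *\<^sub>R axis i 1)) has_field_derivative pderiv_at i \<phi> x) (at 0)"
proof -
  have "(\<lambda>h. \<phi> (x + h *\<^sub>R axis i 1)) differentiable (at 0)"
    by (rule differentiable_compose[where f=\<phi>]) (use assms in \<open>auto intro!: derivative_intros\<close>)
  then show ?thesis
    unfolding pderiv_at_def
    using DERIV_deriv_iff_real_differentiable by blast
qed

lemma pderiv_at_eqI:
  "((\<lambda>h. \<phi> (x + h *\<^sub>R axis i 1)) has_field_derivative d) (at 0) \<Longrightarrow> pderiv_at i \<phi> x = d"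
  unfolding pderiv_at_def by (rule DERIV_imp_deriv)

text \<open>Moves the base point from 0 to any parameter \<open>s\<close> of the coordinate line, as
  the mean value theorem on a segment requires.\<close>

lemma pderiv_at_line:
  assumes "\<phi> differentiable (at (x + s *\<^sub>R axis i 1))"
  shows "((\<lambda>h. \<phi> (x + h *\<^sub>R axis i 1)) has_field_derivative pderiv_at i \<phi> (x + s *\<^sub>R axis i 1)) (at s)"
proof -
  have "((\<lambda>h. \<phi> (x + (h + s) *\<^sub>R axis i 1)) has_field_derivative
      pderiv_at i \<phi> (x + s *\<^sub>R axis i 1)) (at 0)"
    using has_field_derivative_pderiv_at[OF assms, of i] by (simp add: algebra_simps)
  then show ?thesis
    using DERIV_shift[of "\<lambda>h. \<phi> (x + h *\<^sub>R axis i 1)" _ 0 s] by simp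
qed

text \<open>A coordinate line through x stays in U for small parameters. This allows identities
  between components of \<open>D X Y\<close>, which hold on U only, to be differentiated.\<close>

lemma pderiv_at_cong:
  assumes "open U" "x \<in> U" "\<And>y. y \<in> U \<Longrightarrow> \<phi> y = \<psi> y"
  shows "pderiv_at i \<phi> x = pderiv_at i \<psi> x"
proof -
  have "continuous (at 0) (\<lambda>h::real. x + h *\<^sub>R axis i 1)"
    by (intro continuous_intros)
  then have "eventually (\<lambda>h::real. x + h *\<^sub>R axis i 1 \<in> U) (nhds 0)"
    using assms(1,2) by (simp add: continuous_at_open eventually_nhds)
  then have "eventually (\<lambda>h::real. \<phi> (x + h *\<^sub>R axis i 1) = \<psi> (x + h *\<^sub>R axis i 1)) (nhds 0)"
    by (rule eventually_mono) (rule assms(3))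
  then show ?thesis
    unfolding pderiv_at_def by (rule deriv_cong_ev) simp
qed

lemma pderiv_at_const [simp]: "pderiv_at i (\<lambda>y. c) x = 0"
  by (rule pderiv_at_eqI) simp

lemma pderiv_at_add:
  assumes "\<phi> differentiable (at x)" "\<psi> differentiable (at x)"
  shows "pderiv_at i (\<lambda>y. \<phi> y + \<psi> y) x = pderiv_at i \<phi> x + pderiv_at i \<psi> x"
  by (rule pderiv_at_eqI) (intro derivative_intros has_field_derivative_pderiv_at assms)

lemma pderiv_at_diff:
  assumes "\<phi> differentiable (at x)" "\<psi> differentiable (at x)"
  shows "pderiv_at i (\<lambda>y. \<phi> y - \<psi> y) x = pderiv_at i \<phi> x - pderiv_at i \<psi> x"
  by (rule pderiv_at_eqI) (intro derivative_intros has_field_derivative_pderiv_at assms)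

lemma pderiv_at_minus:
  assumes "\<phi> differentiable (at x)"
  shows "pderiv_at i (\<lambda>y. - \<phi> y) x = - pderiv_at i \<phi> x"
  by (rule pderiv_at_eqI) (intro derivative_intros has_field_derivative_pderiv_at assms)

lemma pderiv_at_mult:
  assumes "\<phi> differentiable (at x)" "\<psi> differentiable (at x)"
  shows "pderiv_at i (\<lambda>y. \<phi> y * \<psi> y) x = pderiv_at i \<phi> x * \<psi> x + \<phi> x * pderiv_at i \<psi> x"
  by (rule pderiv_at_eqI)
    (use assms in \<open>auto intro!: derivative_eq_intros has_field_derivative_pderiv_at\<close>)

lemma pderiv_at_sum:
  assumes "\<And>k. k \<in> K \<Longrightarrow> \<phi> k differentiable (at x)"
  shows "pderiv_at i (\<lambda>y. \<Sum>k\<in>K. \<phi> k y) x = (\<Sum>k\<in>K. pderiv_at i (\<phi> k) x)"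
  by (rule pderiv_at_eqI) (intro DERIV_sum has_field_derivative_pderiv_at assms)

lemma pderiv_at_compose:
  assumes "(F has_field_derivative F') (at (\<phi> x))" "\<phi> differentiable (at x)"
  shows "pderiv_at d (\<lambda>y. F (\<phi> y)) x = F' * pderiv_at d \<phi> x"
    and "(\<lambda>y. F (\<phi> y)) differentiable (at x)"
proof -
  show "pderiv_at d (\<lambda>y. F (\<phi> y)) x = F' * pderiv_at d \<phi> x"
    by (rule pderiv_at_eqI, rule DERIV_chain2[OF _ has_field_derivative_pderiv_at[OF assms(2)]])
      (simp add: assms(1))
  have "F differentiable (at (\<phi> x))"
    using assms(1) by (auto simp: real_differentiable_def)
  then show "(\<lambda>y. F (\<phi> y)) differentiable (at x)"
    by (rule differentiable_compose[OF _ assms(2)])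
qed

lemma pderiv_at_divide:
  assumes "\<phi> differentiable (at x)" "\<psi> differentiable (at x)" "\<psi> x \<noteq> 0"
  shows "pderiv_at d (\<lambda>y. \<phi> y / \<psi> y) x =
    pderiv_at d \<phi> x / \<psi> x - \<phi> x * pderiv_at d \<psi> x / (\<psi> x)\<^sup>2"
  by (rule pderiv_at_eqI,
      rule DERIV_divide[OF has_field_derivative_pderiv_at[OF assms(1)]
        has_field_derivative_pderiv_at[OF assms(2)], THEN DERIV_cong])
    (use assms(3) in \<open>simp_all add: field_simps power2_eq_square\<close>)

lemma pderiv_at_divide_square:
  assumes "\<phi> differentiable (at x)" "\<psi> differentiable (at x)" "\<psi> x \<noteq> 0"
  shows "pderiv_at d (\<lambda>y. \<phi> y / (\<psi> y)\<^sup>2) x =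
    pderiv_at d \<phi> x / (\<psi> x)\<^sup>2 - 2 * \<phi> x * pderiv_at d \<psi> x / \<psi> x ^ 3"
  using assms
  by (simp add: power2_eq_square pderiv_at_divide differentiable_mult pderiv_at_mult)
    (simp add: field_simps power2_eq_square power3_eq_cube)

lemma differentiable_coord: "(\<lambda>y. y $ i) differentiable (at (x :: real^'n::finite))"
  by (intro bounded_linear_imp_differentiable bounded_linear_vec_nth)

lemma pderiv_at_coord: "pderiv_at d (\<lambda>y. y $ i) x = (if d = i then 1 else 0)"
  by (rule pderiv_at_eqI) (auto intro!: derivative_eq_intros simp: axis_def)

section \<open>Closure of the classes \<open>Ck_on\<close> under equality on U, constants and
  differences\<close>

lemma Ck_on_cong:
  assumes "open U" "\<And>y. y \<in> U \<Longrightarrow> \<phi> y = \<psi> y" "Ck_on k U \<phi>"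
  shows "Ck_on k U \<psi>"
  using assms(2,3)
proof (induction k arbitrary: \<phi> \<psi>)
  case 0
  then show ?case by (simp cong: continuous_on_cong)
next
  case (Suc k)
  have "\<psi> differentiable_on U"
    using Suc.prems unfolding differentiable_on_def Ck_on.simps
    by (metis differentiable_transform_within zero_less_one)
  moreover have "Ck_on k U (pderiv_at i \<psi>)" for i
  proof (rule Suc.IH)
    show "pderiv_at i \<phi> y = pderiv_at i \<psi> y" if "y \<in> U" for y
      by (rule pderiv_at_cong[OF assms(1) that Suc.prems(1)])
    show "Ck_on k U (pderiv_at i \<phi>)"
      using Suc.prems(2) by simp
  qed
  ultimately show ?case by simp
qed

lemma Ck_on_const: "Ck_on k U (\<lambda>y. c)"
proof (induction k arbitrary: c)
  case (Suc k)
  have "pderiv_at i (\<lambda>y. c) = (\<lambda>y. 0)" for i :: 'a by auto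
  with Suc show ?case by simp
qed simp

lemma Ck_on_diff:
  assumes "open U" "Ck_on k U \<phi>" "Ck_on k U \<psi>"
  shows "Ck_on k U (\<lambda>y. \<phi> y - \<psi> y)"
  using assms(2,3)
proof (induction k arbitrary: \<phi> \<psi>)
  case 0
  then show ?case by (simp add: continuous_on_diff)
next
  case (Suc k)
  have "Ck_on k U (pderiv_at i (\<lambda>y. \<phi> y - \<psi> y))" for i
  proof (rule Ck_on_cong[OF assms(1)])
    show "Ck_on k U (\<lambda>y. pderiv_at i \<phi> y - pderiv_at i \<psi> y)"
      using Suc by simp
    show "pderiv_at i \<phi> y - pderiv_at i \<psi> y = pderiv_at i (\<lambda>y. \<phi> y - \<psi> y) y" if "y \<in> U" for y
      using Suc.prems that assms(1)
      by (intro pderiv_at_diff[symmetric]) (auto simp: differentiable_on_eq_differentiable_at)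
  qed
  with Suc.prems show ?case by (simp add: differentiable_on_diff)
qed

lemma smooth_fun_differentiable:
  "smooth_fun U \<phi> \<Longrightarrow> open U \<Longrightarrow> x \<in> U \<Longrightarrow> \<phi> differentiable (at x)"
  unfolding smooth_fun_def
  by (metis Ck_on.simps(2) differentiable_on_eq_differentiable_at)

lemma smooth_fun_pderiv_at: "smooth_fun U \<phi> \<Longrightarrow> smooth_fun U (pderiv_at i \<phi>)"
  unfolding smooth_fun_def by (metis Ck_on.simps(2))

lemma smooth_fun_continuous: "smooth_fun U \<phi> \<Longrightarrow> continuous_on U \<phi>"
  unfolding smooth_fun_def by (metis Ck_on.simps(1))

lemma smooth_fun_const [simp]: "smooth_fun U (\<lambda>y. c)"
  by (simp add: smooth_fun_def Ck_on_const)

text \<open>Two mean value theorems in succession: in direction i for the increment of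
  \<open>\<phi>\<close> in direction j, then in direction j for
  \<open>pderiv_at i \<phi>\<close>.\<close>

lemma mixed_difference_mvt:
  fixes \<phi> :: "real^'n::finite \<Rightarrow> real"
  assumes "0 < h"
    and "\<And>s t. 0 \<le> s \<Longrightarrow> s \<le> h \<Longrightarrow> 0 \<le> t \<Longrightarrow> t \<le> h \<Longrightarrow> x + s *\<^sub>R axis i 1 + t *\<^sub>R axis j 1 \<in> U"
    and "open U" "smooth_fun U \<phi>"
  obtains s t where "0 < s" "s < h" "0 < t" "t < h"
    "\<phi> (x + h *\<^sub>R axis i 1 + h *\<^sub>R axis j 1) - \<phi> (x + h *\<^sub>R axis i 1) - \<phi> (x + h *\<^sub>R axis j 1) + \<phi> x =
     h\<^sup>2 * pderiv_at j (pderiv_at i \<phi>) (x + s *\<^sub>R axis i 1 + t *\<^sub>R axis j 1)"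
proof -
  let ?ei = "axis i 1 :: real^'n" and ?ej = "axis j 1 :: real^'n"
  \<comment> \<open>With this choice \<open>F h - F 0\<close> is the second difference of the
    claim.\<close>
  define F where "F s = \<phi> ((x + h *\<^sub>R ?ej) + s *\<^sub>R ?ei) - \<phi> (x + s *\<^sub>R ?ei)" for s
  define F' where "F' s = pderiv_at i \<phi> ((x + h *\<^sub>R ?ej) + s *\<^sub>R ?ei) - pderiv_at i \<phi> (x + s *\<^sub>R ?ei)" for s
  have in1: "(x + h *\<^sub>R ?ej) + s *\<^sub>R ?ei \<in> U" "x + s *\<^sub>R ?ei \<in> U" if "0 \<le> s" "s \<le> h" for s
    using assms(2)[of s h] assms(2)[of s 0] that assms(1) by (auto simp: algebra_simps)
  have "(F has_field_derivative F' s) (at s)" if "0 \<le> s" "s \<le> h" for s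
    unfolding F_def F'_def
    by (intro DERIV_diff pderiv_at_line smooth_fun_differentiable[OF assms(4,3)] in1 that)
  from MVT2[OF assms(1) this] obtain s where s: "0 < s" "s < h" "F h - F 0 = h * F' s"
    by auto
  have "((\<lambda>t. pderiv_at i \<phi> ((x + s *\<^sub>R ?ei) + t *\<^sub>R ?ej)) has_field_derivative
      pderiv_at j (pderiv_at i \<phi>) ((x + s *\<^sub>R ?ei) + t *\<^sub>R ?ej)) (at t)"
    if "0 \<le> t" "t \<le> h" for t
    by (intro pderiv_at_line smooth_fun_differentiable[OF smooth_fun_pderiv_at[OF assms(4)] assms(3)]
        assms(2)) (use s that in auto)
  from MVT2[OF assms(1) this] obtain t where t: "0 < t" "t < h"
    "pderiv_at i \<phi> ((x + s *\<^sub>R ?ei) + h *\<^sub>R ?ej) - pderiv_at i \<phi> (x + s *\<^sub>R ?ei) =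
     h * pderiv_at j (pderiv_at i \<phi>) ((x + s *\<^sub>R ?ei) + t *\<^sub>R ?ej)"
    by auto
  have "F h - F 0 = h\<^sup>2 * pderiv_at j (pderiv_at i \<phi>) (x + s *\<^sub>R ?ei + t *\<^sub>R ?ej)"
    using s(3) t(3) by (simp add: F'_def algebra_simps power2_eq_square)
  then show thesis
    using s t by (intro that[of s t]) (auto simp: F_def algebra_simps)
qed

text \<open>Schwarz's theorem. Up to the order of its summands the second difference is symmetric in
  i and j, so both mixed derivatives take a common value at points near x; continuity carries this
  over to x.\<close>

lemma pderiv_at_commute:
  fixes \<phi> :: "real^'n::finite \<Rightarrow> real"
  assumes "open U" "smooth_fun U \<phi>" "x \<in> U"
  shows "pderiv_at i (pderiv_at j \<phi>) x = pderiv_at j (pderiv_at i \<phi>) x"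
proof -
  let ?A = "pderiv_at j (pderiv_at i \<phi>)" and ?B = "pderiv_at i (pderiv_at j \<phi>)"
  have "\<bar>?A x - ?B x\<bar> \<le> e" if "e > 0" for e
  proof -
    have "continuous_on U ?A" "continuous_on U ?B"
      by (intro smooth_fun_continuous smooth_fun_pderiv_at assms)+
    then have "isCont ?A x" "isCont ?B x"
      using assms by (auto simp: continuous_on_eq_continuous_at)
    then have "\<exists>d>0. \<forall>y. dist y x < d \<longrightarrow> dist (?A y) (?A x) < e/2"
      "\<exists>d>0. \<forall>y. dist y x < d \<longrightarrow> dist (?B y) (?B x) < e/2"
      using that half_gt_zero unfolding continuous_at_eps_delta by metis+
    moreover obtain d0 where "d0 > 0" "\<And>y. dist y x < d0 \<Longrightarrow> y \<in> U"
      using assms(1,3) unfolding open_dist by blast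
    ultimately obtain d1 d2 where d: "d1 > 0" "d2 > 0" "d0 > 0"
      "\<And>y. dist y x < d1 \<Longrightarrow> dist (?A y) (?A x) < e/2"
      "\<And>y. dist y x < d2 \<Longrightarrow> dist (?B y) (?B x) < e/2"
      "\<And>y. dist y x < d0 \<Longrightarrow> y \<in> U"
      by blast
    \<comment> \<open>The square of side h lies within distance 2 h of x; the divisor 3 keeps 2 h
      strictly below all three radii.\<close>
    define h where "h = min d0 (min d1 d2) / 3"
    have h: "h > 0" "2 * h < d0" "2 * h < d1" "2 * h < d2"
      using d(1-3) by (auto simp: h_def min_def)
    have near: "dist (x + s *\<^sub>R axis k 1 + t *\<^sub>R axis l 1) x \<le> 2 * h"
      if "0 \<le> s" "s \<le> h" "0 \<le> t" "t \<le> h" for s t and k l :: 'n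
    proof -
      have "norm (s *\<^sub>R axis k 1 + t *\<^sub>R axis l (1::real)) \<le> s + t"
        using norm_triangle_ineq[of "s *\<^sub>R axis k 1" "t *\<^sub>R axis l (1::real)"] that by (simp add: norm_axis_1)
      with that show ?thesis by (simp add: dist_norm add.assoc)
    qed
    have inU: "x + s *\<^sub>R axis k 1 + t *\<^sub>R axis l 1 \<in> U"
      if "0 \<le> s" "s \<le> h" "0 \<le> t" "t \<le> h" for s t and k l :: 'n
      using near[OF that] h d(6) by (meson order.strict_trans1)
    obtain s t where A: "0 < s" "s < h" "0 < t" "t < h"
      "\<phi> (x + h *\<^sub>R axis i 1 + h *\<^sub>R axis j 1) - \<phi> (x + h *\<^sub>R axis i 1) - \<phi> (x + h *\<^sub>R axis j 1) + \<phi> x =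
       h\<^sup>2 * ?A (x + s *\<^sub>R axis i 1 + t *\<^sub>R axis j 1)"
      by (rule mixed_difference_mvt[OF h(1) inU assms(1,2)])
    obtain s' t' where B: "0 < s'" "s' < h" "0 < t'" "t' < h"
      "\<phi> (x + h *\<^sub>R axis j 1 + h *\<^sub>R axis i 1) - \<phi> (x + h *\<^sub>R axis j 1) - \<phi> (x + h *\<^sub>R axis i 1) + \<phi> x =
       h\<^sup>2 * ?B (x + s' *\<^sub>R axis j 1 + t' *\<^sub>R axis i 1)"
      by (rule mixed_difference_mvt[OF h(1) inU assms(1,2)])
    have "h\<^sup>2 * ?A (x + s *\<^sub>R axis i 1 + t *\<^sub>R axis j 1) = h\<^sup>2 * ?B (x + s' *\<^sub>R axis j 1 + t' *\<^sub>R axis i 1)"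
      using A(5) B(5) by (simp add: algebra_simps)
    then have "?A (x + s *\<^sub>R axis i 1 + t *\<^sub>R axis j 1) = ?B (x + s' *\<^sub>R axis j 1 + t' *\<^sub>R axis i 1)"
      using h(1) by simp
    moreover have "dist (?A (x + s *\<^sub>R axis i 1 + t *\<^sub>R axis j 1)) (?A x) < e/2"
      using near[of s t i j] A h by (intro d(4)) auto
    moreover have "dist (?B (x + s' *\<^sub>R axis j 1 + t' *\<^sub>R axis i 1)) (?B x) < e/2"
      using near[of s' t' j i] B h by (intro d(5)) auto
    ultimately show ?thesis
      unfolding dist_real_def by linarith
  qed
  then have "\<bar>?A x - ?B x\<bar> \<le> 0"
    using field_le_epsilon[of "\<bar>?A x - ?B x\<bar>" 0] by (metis add_0)
  then show ?thesis by simp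
qed

subsection \<open>Connections in coordinates\<close>

lemma smooth_vfield_coord [simp]: "smooth_vfield U (coord_vfield i)"
  by (simp add: smooth_vfield_def coord_vfield_def)

lemma vfield_apply_coord: "vfield_apply (coord_vfield i) \<phi> x = pderiv_at i \<phi> x"
  by (simp add: vfield_apply_def coord_vfield_def axis_def if_distrib[of "\<lambda>c. c * _"] cong: if_cong)

lemma lie_bracket_coord: "lie_bracket (coord_vfield i) (coord_vfield j) = (\<lambda>x. 0)"
  by (rule ext) (simp add: lie_bracket_def vfield_apply_coord vec_eq_iff, simp add: coord_vfield_def)

lemma vfield_expansion: "X = (\<lambda>y. \<Sum>j\<in>UNIV. (X y $ j) *\<^sub>R coord_vfield j y)"
  using basis_expansion[of "X _"] by (simp add: coord_vfield_def scalar_mult_eq_scaleR)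

lemma smooth_vfield_component: "smooth_vfield U X \<Longrightarrow> smooth_fun U (\<lambda>y. X y $ k)"
  by (simp add: smooth_vfield_def)

section \<open>Coordinate formulas for an affine connection\<close>

context
  fixes U :: "(real^'n::finite) set" and D :: "'n connection"
  assumes U: "open U" and D: "affine_connection U D"
begin

lemma smooth_vfield_connection:
  "smooth_vfield U X \<Longrightarrow> smooth_vfield U Y \<Longrightarrow> smooth_vfield U (D X Y)"
  using D by (simp add: affine_connection_def)

lemma connection_add:
  assumes "smooth_vfield U X" "smooth_vfield U Y" "smooth_vfield U Z" "x \<in> U"
  shows "D (\<lambda>y. X y + Y y) Z x = D X Z x + D Y Z x"
    and "D Z (\<lambda>y. X y + Y y) x = D Z X x + D Z Y x"
  using D assms unfolding affine_connection_def by blast+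

lemma connection_scale:
  assumes "smooth_fun U \<phi>" "smooth_vfield U X" "smooth_vfield U Y" "x \<in> U"
  shows "D (\<lambda>y. \<phi> y *\<^sub>R X y) Y x = \<phi> x *\<^sub>R D X Y x"
    and "D X (\<lambda>y. \<phi> y *\<^sub>R Y y) x = vfield_apply X \<phi> x *\<^sub>R Y x + \<phi> x *\<^sub>R D X Y x"
  using D assms unfolding affine_connection_def by blast+

lemma connection_zero:
  assumes "smooth_vfield U X" "x \<in> U"
  shows "D (\<lambda>y. 0) X x = 0" and "D X (\<lambda>y. 0) x = 0"
  using connection_scale[of "\<lambda>y. 0", OF smooth_fun_const assms(1) assms(1,2)]
  by (simp_all add: vfield_apply_def)

text \<open>Supplies the smoothness side conditions when a field is expanded by induction over
  finite sets of indices: each component of a partial sum is a component of X or zero.\<close>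

lemma smooth_vfield_partial_expansion:
  assumes "smooth_vfield U X" "finite A"
  shows "smooth_vfield U (\<lambda>y. \<Sum>j\<in>A. (X y $ j) *\<^sub>R coord_vfield j y)"
proof -
  have "(\<Sum>j\<in>A. (X y $ j) *\<^sub>R coord_vfield j y) $ k = (if k \<in> A then X y $ k else 0)" for y k
    using assms(2) by (simp add: coord_vfield_def axis_def if_distrib[of "\<lambda>c. _ * c"] cong: if_cong)
  moreover have "smooth_fun U (\<lambda>y. if k \<in> A then X y $ k else 0)" for k
    using smooth_vfield_component[OF assms(1)] by (cases "k \<in> A") auto
  ultimately show ?thesis
    unfolding smooth_vfield_def by presburger
qed

lemma smooth_vfield_single:
  assumes "smooth_vfield U X"
  shows "smooth_vfield U (\<lambda>y. (X y $ j) *\<^sub>R coord_vfield j y)"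
  using smooth_vfield_partial_expansion[OF assms, of "{j}"] by simp

lemma connection_left_expansion:
  assumes X: "smooth_vfield U X" and Y: "smooth_vfield U Y" and x: "x \<in> U"
  shows "D X Y x = (\<Sum>i\<in>UNIV. X x $ i *\<^sub>R D (coord_vfield i) Y x)"
proof -
  have "D (\<lambda>y. \<Sum>j\<in>A. (X y $ j) *\<^sub>R coord_vfield j y) Y x = (\<Sum>i\<in>A. X x $ i *\<^sub>R D (coord_vfield i) Y x)"
    if "finite A" for A
    using that
  proof induction
    case empty
    show ?case using connection_zero[OF Y x] by simp
  next
    case (insert j A)
    then show ?case
      using connection_add(1)[OF smooth_vfield_single[OF X, of j]
          smooth_vfield_partial_expansion[OF X insert(1)] Y x]
        connection_scale(1)[OF smooth_vfield_component[OF X] smooth_vfield_coord Y x, of j j]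
      by simp
  qed
  from this[of UNIV] show ?thesis
    by (subst vfield_expansion) simp
qed

text \<open>The Leibniz rule applied to the coordinate expansion of Y. The second factor in the sum
  is the Christoffel symbol, so all later work with D can be done on components.\<close>

lemma connection_coord_component:
  assumes Y: "smooth_vfield U Y" and x: "x \<in> U"
  shows "D (coord_vfield i) Y x $ k = pderiv_at i (\<lambda>y. Y y $ k) x
    + (\<Sum>j\<in>UNIV. Y x $ j * D (coord_vfield i) (coord_vfield j) x $ k)"
proof -
  have "D (coord_vfield i) (\<lambda>y. \<Sum>j\<in>A. (Y y $ j) *\<^sub>R coord_vfield j y) x =
     (\<Sum>j\<in>A. pderiv_at i (\<lambda>y. Y y $ j) x *\<^sub>R axis j 1 + Y x $ j *\<^sub>R D (coord_vfield i) (coord_vfield j) x)"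
    if "finite A" for A
    using that
  proof induction
    case empty
    show ?case using connection_zero[OF smooth_vfield_coord x] by simp
  next
    case (insert j A)
    then show ?case
      using connection_add(2)[OF smooth_vfield_single[OF Y, of j]
          smooth_vfield_partial_expansion[OF Y insert(1)] smooth_vfield_coord[of _ i] x]
        connection_scale(2)[OF smooth_vfield_component[OF Y, of j] smooth_vfield_coord[of _ i]
          smooth_vfield_coord[of _ j] x]
      by (simp add: vfield_apply_coord) (simp add: coord_vfield_def)
  qed
  from this[of UNIV] have "D (coord_vfield i) Y x =
     (\<Sum>j\<in>UNIV. pderiv_at i (\<lambda>y. Y y $ j) x *\<^sub>R axis j 1 + Y x $ j *\<^sub>R D (coord_vfield i) (coord_vfield j) x)"
    by (subst vfield_expansion) simp
  then show ?thesis
    by (simp add: sum.distrib axis_def if_distrib[of "\<lambda>c. _ * c"] cong: if_cong)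
qed

lemma differentiable_component:
  "smooth_vfield U X \<Longrightarrow> x \<in> U \<Longrightarrow> (\<lambda>y. X y $ k) differentiable (at x)"
  by (rule smooth_fun_differentiable[OF smooth_vfield_component U])

text \<open>The Leibniz rule for the sum of the fields \<open>X\<^sup>i D\<^sub>i Z\<close>,
  obtained by differentiating components, where the product rule for functions suffices.\<close>

lemma connection_coord_connection:
  assumes X: "smooth_vfield U X" and Z: "smooth_vfield U Z" and x: "x \<in> U"
  shows "D (coord_vfield j) (D X Z) x $ k =
    (\<Sum>i\<in>UNIV. pderiv_at j (\<lambda>y. X y $ i) x * D (coord_vfield i) Z x $ k
       + X x $ i * D (coord_vfield j) (D (coord_vfield i) Z) x $ k)"
proof -
  have DZ: "smooth_vfield U (D (coord_vfield i) Z)" for i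
    by (intro smooth_vfield_connection smooth_vfield_coord Z)
  have exp: "D X Z y $ k = (\<Sum>i\<in>UNIV. X y $ i * D (coord_vfield i) Z y $ k)" if "y \<in> U" for y k
    by (simp add: connection_left_expansion[OF X Z that])
  have "pderiv_at j (\<lambda>y. D X Z y $ k) x
      = pderiv_at j (\<lambda>y. \<Sum>i\<in>UNIV. X y $ i * D (coord_vfield i) Z y $ k) x"
    by (rule pderiv_at_cong[OF U x exp])
  also have "\<dots> = (\<Sum>i\<in>UNIV. pderiv_at j (\<lambda>y. X y $ i * D (coord_vfield i) Z y $ k) x)"
    by (intro pderiv_at_sum differentiable_mult differentiable_component X DZ x)
  also have "\<dots> = (\<Sum>i\<in>UNIV. pderiv_at j (\<lambda>y. X y $ i) x * D (coord_vfield i) Z x $ k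
      + X x $ i * pderiv_at j (\<lambda>y. D (coord_vfield i) Z y $ k) x)"
    by (intro sum.cong refl pderiv_at_mult differentiable_component X DZ x)
  finally show ?thesis
    by (simp add: connection_coord_component[OF smooth_vfield_connection[OF X Z] x]
        connection_coord_component[OF DZ x] exp[OF x] sum.distrib sum_distrib_left sum_distrib_right
        distrib_left mult.assoc)
      (rule sum.swap)
qed

text \<open>Sorted by the order of differentiation of Z: the second-order and first-order parts are
  symmetric in i and j, so the commutator will retain only the part of order zero.\<close>

lemma connection_coord_coord:
  assumes Z: "smooth_vfield U Z" and x: "x \<in> U"
  shows "D (coord_vfield j) (D (coord_vfield i) Z) x $ k =
    pderiv_at j (pderiv_at i (\<lambda>y. Z y $ k)) x
    + (\<Sum>l\<in>UNIV. pderiv_at j (\<lambda>y. Z y $ l) x * D (coord_vfield i) (coord_vfield l) x $ k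
         + pderiv_at i (\<lambda>y. Z y $ l) x * D (coord_vfield j) (coord_vfield l) x $ k)
    + (\<Sum>l\<in>UNIV. Z x $ l * D (coord_vfield j) (D (coord_vfield i) (coord_vfield l)) x $ k)"
proof -
  let ?\<Gamma> = "\<lambda>i l y. D (coord_vfield i) (coord_vfield l) y"
  have G: "smooth_vfield U (D (coord_vfield i) (coord_vfield l))" for l i
    by (intro smooth_vfield_connection smooth_vfield_coord)
  have exp: "D (coord_vfield i) Z y $ k = pderiv_at i (\<lambda>y. Z y $ k) y + (\<Sum>l\<in>UNIV. Z y $ l * ?\<Gamma> i l y $ k)"
    if "y \<in> U" for y k
    by (rule connection_coord_component[OF Z that])
  have d: "pderiv_at i (\<lambda>y. Z y $ k) differentiable (at x)"
    by (rule smooth_fun_differentiable[OF smooth_fun_pderiv_at[OF smooth_vfield_component[OF Z]] U x])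
  have "pderiv_at j (\<lambda>y. D (coord_vfield i) Z y $ k) x
      = pderiv_at j (\<lambda>y. pderiv_at i (\<lambda>y. Z y $ k) y + (\<Sum>l\<in>UNIV. Z y $ l * ?\<Gamma> i l y $ k)) x"
    by (rule pderiv_at_cong[OF U x exp])
  also have "\<dots> = pderiv_at j (pderiv_at i (\<lambda>y. Z y $ k)) x
      + pderiv_at j (\<lambda>y. \<Sum>l\<in>UNIV. Z y $ l * ?\<Gamma> i l y $ k) x"
    by (auto intro!: pderiv_at_add d differentiable_sum differentiable_mult differentiable_component Z G x)
  also have "pderiv_at j (\<lambda>y. \<Sum>l\<in>UNIV. Z y $ l * ?\<Gamma> i l y $ k) x
      = (\<Sum>l\<in>UNIV. pderiv_at j (\<lambda>y. Z y $ l * ?\<Gamma> i l y $ k) x)"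
    by (intro pderiv_at_sum differentiable_mult differentiable_component Z G x)
  also have "\<dots> = (\<Sum>l\<in>UNIV. pderiv_at j (\<lambda>y. Z y $ l) x * ?\<Gamma> i l x $ k
      + Z x $ l * pderiv_at j (\<lambda>y. ?\<Gamma> i l y $ k) x)"
    by (intro sum.cong refl pderiv_at_mult differentiable_component Z G x)
  finally have "D (coord_vfield j) (D (coord_vfield i) Z) x $ k =
    pderiv_at j (pderiv_at i (\<lambda>y. Z y $ k)) x
    + (\<Sum>l\<in>UNIV. pderiv_at j (\<lambda>y. Z y $ l) x * ?\<Gamma> i l x $ k
         + pderiv_at i (\<lambda>y. Z y $ l) x * ?\<Gamma> j l x $ k)
    + ((\<Sum>l\<in>UNIV. Z x $ l * pderiv_at j (\<lambda>y. ?\<Gamma> i l y $ k) x)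
        + (\<Sum>m\<in>UNIV. (\<Sum>l\<in>UNIV. Z x $ l * ?\<Gamma> i l x $ m) * ?\<Gamma> j m x $ k))"
    using connection_coord_component[OF smooth_vfield_connection[OF smooth_vfield_coord Z] x, of j i k]
    by (simp add: exp[OF x] sum.distrib distrib_right)
  \<comment> \<open>Regrouped by components of Z, the quadratic Christoffel terms join the
    derivatives of the symbols to form the second covariant derivatives of the coordinate
    fields.\<close>
  also have "(\<Sum>m\<in>UNIV. (\<Sum>l\<in>UNIV. Z x $ l * ?\<Gamma> i l x $ m) * ?\<Gamma> j m x $ k)
      = (\<Sum>l\<in>UNIV. Z x $ l * (\<Sum>m\<in>UNIV. ?\<Gamma> i l x $ m * ?\<Gamma> j m x $ k))"
    by (simp add: sum_distrib_left sum_distrib_right mult.assoc) (rule sum.swap)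
  finally show ?thesis
    by (simp add: connection_coord_component[OF G x] sum.distrib distrib_left)
qed

section \<open>The curvature operator in coordinates and its tensoriality\<close>

lemma curvature_op_coord:
  assumes "x \<in> U"
  shows "curvature_op D (coord_vfield i) (coord_vfield j) (coord_vfield l) x $ k =
    D (coord_vfield j) (D (coord_vfield i) (coord_vfield l)) x $ k
    - D (coord_vfield i) (D (coord_vfield j) (coord_vfield l)) x $ k"
  by (simp add: curvature_op_def lie_bracket_coord connection_zero[OF smooth_vfield_coord assms])

text \<open>The classical formula in Christoffel symbols, with i and j interchanged relative to many
  textbooks because of the sign of \<open>curvature_op\<close>.\<close>

lemma curvature_op_christoffel:
  assumes "x \<in> U"
  shows "curvature_op D (coord_vfield i) (coord_vfield j) (coord_vfield l) x $ k =
    pderiv_at j (\<lambda>y. D (coord_vfield i) (coord_vfield l) y $ k) x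
    - pderiv_at i (\<lambda>y. D (coord_vfield j) (coord_vfield l) y $ k) x
    + (\<Sum>m\<in>UNIV. D (coord_vfield i) (coord_vfield l) x $ m * D (coord_vfield j) (coord_vfield m) x $ k
         - D (coord_vfield j) (coord_vfield l) x $ m * D (coord_vfield i) (coord_vfield m) x $ k)"
  using connection_coord_component[OF smooth_vfield_connection[OF smooth_vfield_coord smooth_vfield_coord] assms]
  by (simp add: curvature_op_coord[OF assms] sum_subtractf)

text \<open>Vanishing torsion makes the bracket equal to \<open>D X Y - D Y X\<close> on U, and D
  preserves smoothness.\<close>

lemma smooth_vfield_lie_bracket:
  assumes "torsion_free U D" "smooth_vfield U X" "smooth_vfield U Y"
  shows "smooth_vfield U (lie_bracket X Y)"
  unfolding smooth_vfield_def smooth_fun_def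
proof (intro allI)
  fix i k
  have "D X Y y $ i - D Y X y $ i = lie_bracket X Y y $ i" if "y \<in> U" for y
    using assms that unfolding torsion_free_def by (metis vector_minus_component)
  moreover have "Ck_on k U (\<lambda>y. D X Y y $ i - D Y X y $ i)"
    using smooth_vfield_connection assms(2,3) unfolding smooth_vfield_def smooth_fun_def
    by (intro Ck_on_diff[OF U]) blast+
  ultimately show "Ck_on k U (\<lambda>y. lie_bracket X Y y $ i)"
    by (rule Ck_on_cong[OF U])
qed

text \<open>Derivatives of X and Y cancel against the bracket term, and derivatives of Z cancel by
  the symmetry visible in \<open>connection_coord_coord\<close>.\<close>

lemma curvature_op_tensorial:
  assumes tf: "torsion_free U D"
    and X: "smooth_vfield U X" and Y: "smooth_vfield U Y" and Z: "smooth_vfield U Z" and x: "x \<in> U"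
  shows "curvature_op D X Y Z x $ k = (\<Sum>i\<in>UNIV. \<Sum>j\<in>UNIV. \<Sum>l\<in>UNIV. X x $ i * Y x $ j * Z x $ l *
    curvature_op D (coord_vfield i) (coord_vfield j) (coord_vfield l) x $ k)"
proof -
  let ?E = "\<lambda>i. D (coord_vfield i) Z x $ k"
  let ?C = "\<lambda>i j. D (coord_vfield j) (D (coord_vfield i) Z) x $ k"
  \<comment> \<open>The first double sum collects the derivatives of A, the second one only values
    of A and B.\<close>
  have DD: "D B (D A Z) x $ k = (\<Sum>j\<in>UNIV. \<Sum>i\<in>UNIV. B x $ j * pderiv_at j (\<lambda>y. A y $ i) x * ?E i)
       + (\<Sum>j\<in>UNIV. \<Sum>i\<in>UNIV. B x $ j * A x $ i * ?C i j)"
    if "smooth_vfield U A" "smooth_vfield U B" for A B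
    by (simp add: connection_left_expansion[OF that(2) smooth_vfield_connection[OF that(1) Z] x]
        connection_coord_connection[OF that(1) Z x] sum_distrib_left sum.distrib distrib_left mult.assoc)
  \<comment> \<open>These are the derivative sums of \<open>DD\<close> for the two orders of X and
    Y, with the sign that cancels them in \<open>curvature_op\<close>.\<close>
  have br: "D (lie_bracket X Y) Z x $ k =
      (\<Sum>j\<in>UNIV. \<Sum>i\<in>UNIV. X x $ j * pderiv_at j (\<lambda>y. Y y $ i) x * ?E i)
      - (\<Sum>j\<in>UNIV. \<Sum>i\<in>UNIV. Y x $ j * pderiv_at j (\<lambda>y. X y $ i) x * ?E i)"
    by (subst (1 2) sum.swap)
      (simp add: connection_left_expansion[OF smooth_vfield_lie_bracket[OF tf X Y] Z x]
        lie_bracket_def vfield_apply_def sum_distrib_right left_diff_distrib sum_subtractf)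
  have sw: "(\<Sum>j\<in>UNIV. \<Sum>i\<in>UNIV. Y x $ j * X x $ i * ?C i j) = (\<Sum>i\<in>UNIV. \<Sum>j\<in>UNIV. X x $ i * Y x $ j * ?C i j)"
    by (subst sum.swap) (simp add: mult.commute)
  have "?C i j - ?C j i = (\<Sum>l\<in>UNIV. Z x $ l *
      curvature_op D (coord_vfield i) (coord_vfield j) (coord_vfield l) x $ k)" for i j
    using pderiv_at_commute[OF U smooth_vfield_component[OF Z] x, of j i k]
    by (simp add: connection_coord_coord[OF Z x] curvature_op_coord[OF x] right_diff_distrib
        sum_subtractf sum.distrib)
  moreover have "curvature_op D X Y Z x $ k = (\<Sum>i\<in>UNIV. \<Sum>j\<in>UNIV. X x $ i * Y x $ j * (?C i j - ?C j i))"
    by (simp add: curvature_op_def DD[OF X Y] DD[OF Y X] br sw right_diff_distrib sum_subtractf)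
  ultimately show ?thesis
    by (simp add: sum_distrib_left mult.assoc)
qed

end

section \<open>Christoffel symbols of a Levi-Civita connection and the Ricci trace\<close>

lemma christoffel_symmetric:
  assumes "torsion_free U D" "x \<in> U"
  shows "D (coord_vfield i) (coord_vfield j) x = D (coord_vfield j) (coord_vfield i) x"
proof -
  have "D (coord_vfield i) (coord_vfield j) x - D (coord_vfield j) (coord_vfield i) x = 0"
    using assms unfolding torsion_free_def
    by (metis smooth_vfield_coord lie_bracket_coord)
  then show ?thesis by simp
qed

lemma eval02_coord_right:
  "eval02 g X (coord_vfield k) x = (\<Sum>m\<in>UNIV. X x $ m * g x $ m $ k)"
  by (simp add: eval02_def coord_vfield_def axis_def if_distrib[of "\<lambda>c. _ * c"] cong: if_cong)
    (simp add: mult.commute)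

lemma eval02_coord_left:
  "eval02 g (coord_vfield k) X x = (\<Sum>m\<in>UNIV. X x $ m * g x $ k $ m)"
  unfolding eval02_def
  by (subst sum.swap)
    (simp add: coord_vfield_def axis_def if_distrib[of "\<lambda>c. _ * c"] if_distrib[of "\<lambda>c. c * _"] cong: if_cong,
      simp add: mult.commute)

lemma eval02_coord: "eval02 g (coord_vfield i) (coord_vfield j) x = g x $ i $ j"
  unfolding eval02_coord_right
  by (simp add: coord_vfield_def axis_def if_distrib[of "\<lambda>c. c * _"] cong: if_cong)

text \<open>Metric compatibility writes each derivative of g as two lowered Christoffel symbols. In
  the alternating sum of three such equations, symmetry of the symbols in the lower indices leaves
  one of them, twice.\<close>

lemma koszul_coord:
  assumes lc: "levi_civita U g D" and x: "x \<in> U"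
    and sym: "\<And>y i j. g y $ i $ j = g y $ j $ i"
  shows "2 * (\<Sum>m\<in>UNIV. D (coord_vfield i) (coord_vfield j) x $ m * g x $ m $ k) =
    pderiv_at i (\<lambda>y. g y $ j $ k) x + pderiv_at j (\<lambda>y. g y $ i $ k) x - pderiv_at k (\<lambda>y. g y $ i $ j) x"
proof -
  let ?L = "\<lambda>i j k. \<Sum>m\<in>UNIV. D (coord_vfield i) (coord_vfield j) x $ m * g x $ m $ k"
  have tf: "torsion_free U D" and mc: "metric_compatible U g D"
    using lc by (auto simp: levi_civita_def)
  have L_sym: "?L i j k = ?L j i k" for i j k
    by (simp add: christoffel_symmetric[OF tf x, of i j])
  have g_coord: "eval02 g (coord_vfield j) (coord_vfield k) = (\<lambda>y. g y $ j $ k)" for j k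
    by (rule ext) (rule eval02_coord)
  have "pderiv_at i (\<lambda>y. g y $ j $ k) x = ?L i j k + ?L i k j" for i j k
  proof -
    have "vfield_apply (coord_vfield i) (eval02 g (coord_vfield j) (coord_vfield k)) x =
      eval02 g (D (coord_vfield i) (coord_vfield j)) (coord_vfield k) x
      + eval02 g (coord_vfield j) (D (coord_vfield i) (coord_vfield k)) x"
      using mc x unfolding metric_compatible_def by (metis smooth_vfield_coord)
    then show ?thesis
      by (simp add: vfield_apply_coord g_coord eval02_coord_right eval02_coord_left sym[of x j])
  qed
  then show ?thesis
    using L_sym[of i j k] L_sym[of k i j] L_sym[of k j i] by simp
qed

text \<open>\<open>riemann\<close> lowers the output index with g and \<open>ricci\<close> raises it
  again, so the Ricci tensor is the trace over the first argument and the output of the curvature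
  operator. The entries of the inverse metric never have to be computed.\<close>

lemma ricci_trace:
  assumes sym: "\<And>i j. g x $ i $ j = g x $ j $ i" and inv: "invertible (g x)"
  shows "ricci g D x $ j $ k =
    (\<Sum>i\<in>UNIV. curvature_op D (coord_vfield i) (coord_vfield j) (coord_vfield k) x $ i)"
proof -
  let ?R = "\<lambda>i. curvature_op D (coord_vfield i) (coord_vfield j) (coord_vfield k) x"
  \<comment> \<open>\<open>matrix_inv\<close> is defined by choice; invertibility guarantees that
    the chosen matrix is an inverse.\<close>
  have "matrix_inv (g x) ** g x = mat 1"
    using inv unfolding matrix_inv_def invertible_def by (rule someI2_ex) simp
  then have *: "(\<Sum>l\<in>UNIV. matrix_inv (g x) $ i $ l * g x $ m $ l) = (if i = m then 1 else 0)" for i m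
    using sym[of m] by (simp add: matrix_matrix_mult_def mat_def vec_eq_iff)
  have "(\<Sum>l\<in>UNIV. matrix_inv (g x) $ i $ l * riemann g D (coord_vfield i) (coord_vfield j) (coord_vfield k) (coord_vfield l) x)
      = (\<Sum>m\<in>UNIV. ?R i $ m * (\<Sum>l\<in>UNIV. matrix_inv (g x) $ i $ l * g x $ m $ l))" for i
    unfolding riemann_def eval02_coord_right sum_distrib_left
    by (subst sum.swap) (simp add: mult.left_commute)
  then show ?thesis
    by (simp add: ricci_def * if_distrib[of "\<lambda>c. _ * c"] cong: if_cong)
qed

subsection \<open>The Robinson-Trautman metric\<close>

lemma vector_4 [simp]:
  "(vector [w, x, y, z] :: 'a::zero^4) $ 1 = w"
  "(vector [w, x, y, z] :: 'a::zero^4) $ 2 = x"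
  "(vector [w, x, y, z] :: 'a::zero^4) $ 3 = y"
  "(vector [w, x, y, z] :: 'a::zero^4) $ 4 = z"
  unfolding vector_def by simp_all

lemma x34_line:
  "x34 (x + h *\<^sub>R axis i 1) =
    x34 x + h *\<^sub>R (if i = 3 then axis 1 1 else if i = 4 then axis 2 1 else 0)"
  by (auto simp: x34_def vec_eq_iff forall_2 axis_def)

text \<open>An equality of functions, read off from the difference quotients; it can therefore be
  rewritten under a further derivative.\<close>

lemma pderiv_at_x34:
  "pderiv_at i (\<lambda>y. \<phi> (x34 y)) =
    (if i = 3 then (\<lambda>y. pderiv_at 1 \<phi> (x34 y))
     else if i = 4 then (\<lambda>y. pderiv_at 2 \<phi> (x34 y)) else (\<lambda>y. 0))"
  by (auto simp: pderiv_at_def x34_line fun_eq_iff)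

lemma linear_x34: "linear x34"
  by (rule linearI) (auto simp: x34_def vec_eq_iff forall_2)

lemma open_x34_image: "open M \<Longrightarrow> open (x34 ` M)"
proof (rule open_surjective_linear_image[OF _ linear_x34])
  have "x34 (vector [0, 0, y $ 1, y $ 2]) = y" for y
    by (simp add: x34_def vec_eq_iff forall_2)
  then show "surj x34" by (rule surjI)
qed

text \<open>Partial derivatives of a pullback are zero or again pullbacks, hence the induction over
  all \<open>\<phi>\<close>. Openness of the image gives differentiability at its points.\<close>

lemma Ck_on_x34:
  assumes "open M" "Ck_on k (x34 ` M) \<phi>"
  shows "Ck_on k M (\<lambda>y. \<phi> (x34 y))"
  using assms(2)
proof (induction k arbitrary: \<phi>)
  case 0
  then show ?case
    by (auto intro: continuous_on_compose2[OF _ linear_continuous_on] simp: linear_linear linear_x34)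
next
  case (Suc k)
  have "(\<lambda>y. \<phi> (x34 y)) differentiable (at x)" if "x \<in> M" for x
  proof (rule differentiable_compose[where f=\<phi>])
    show "\<phi> differentiable at (x34 x)"
      using Suc.prems that open_x34_image[OF assms(1)]
      by (auto simp: differentiable_on_eq_differentiable_at)
    show "x34 differentiable at x"
      by (rule linear_imp_differentiable[OF linear_x34])
  qed
  then have "(\<lambda>y. \<phi> (x34 y)) differentiable_on M"
    by (simp add: assms(1) differentiable_on_eq_differentiable_at)
  moreover have "Ck_on k M (pderiv_at i (\<lambda>y. \<phi> (x34 y)))" for i
    using Suc by (auto simp: pderiv_at_x34 Ck_on_const)
  ultimately show ?case by simp
qed

lemma smooth_fun_x34: "open M \<Longrightarrow> smooth_fun (x34 ` M) \<phi> \<Longrightarrow> smooth_fun M (\<lambda>y. \<phi> (x34 y))"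
  by (simp add: smooth_fun_def Ck_on_x34)

section \<open>The two blocks of the metric and the algebra of its Christoffel symbols\<close>

definition rt_h :: "real \<Rightarrow> real \<Rightarrow> real \<Rightarrow> real \<Rightarrow> real" where
  "rt_h a b q r = a - 2 * b * r - q / r"

definition rt_h' :: "real \<Rightarrow> real \<Rightarrow> real \<Rightarrow> real" where
  "rt_h' b q r = q / r\<^sup>2 - 2 * b"

definition base_form :: "real \<Rightarrow> real^4^4" where
  "base_form h = vector [vector [- 2 * h, 1, 0, 0], vector [1, 0, 0, 0], 0, 0]"

definition fibre_form :: "real \<Rightarrow> real^4^4" where
  "fibre_form k = vector [0, 0, vector [0, 0, k, 0], vector [0, 0, 0, k]]"

text \<open>Entry \<open>(i, j, k)\<close> is the Christoffel symbol \<open>\<Gamma>\<close> with lower indices \<open>i, j\<close> and upper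
  index \<open>k\<close>; the parameters stand for \<open>h'\<close>, \<open>2 h h'\<close>, \<open>1 / r\<close>, \<open>r / f\<^sup>2\<close>, \<open>2 h r / f\<^sup>2\<close>,
  \<open>f\<^sub>3 / f\<close>, \<open>f\<^sub>4 / f\<close>. As the table is linear in them, it also represents the derivatives of the symbols.\<close>

definition christoffel_table ::
  "real \<Rightarrow> real \<Rightarrow> real \<Rightarrow> real \<Rightarrow> real \<Rightarrow> real \<Rightarrow> real \<Rightarrow> real^4^4^4" where
  "christoffel_table u v s m n k3 k4 = vector
    [vector [vector [u, v, 0, 0], vector [0, - u, 0, 0], 0, 0],
     vector [vector [0, - u, 0, 0], 0, vector [0, 0, s, 0], vector [0, 0, 0, s]],
     vector [0, vector [0, 0, s, 0], vector [m, n, - k3, k4], vector [0, 0, - k4, - k3]],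
     vector [0, vector [0, 0, 0, s], vector [0, 0, - k4, - k3], vector [m, n, k3, - k4]]]"

lemma robinson_trautman_split:
  "robinson_trautman a b q f x =
    base_form (rt_h a b q (x $ 2)) + fibre_form (- ((x $ 2)\<^sup>2 / (f (x34 x))\<^sup>2))"
  by (simp add: robinson_trautman_def base_form_def fibre_form_def rt_h_def Let_def vec_eq_iff forall_4)

lemma form_symmetric:
  "(base_form h + fibre_form k) $ i $ j = (base_form h + fibre_form k) $ j $ i"
  using exhaust_4[of i] exhaust_4[of j]
  by (elim disjE) (simp_all add: base_form_def fibre_form_def)

lemma form_invertible:
  assumes "k \<noteq> 0"
  shows "invertible (base_form h + fibre_form k)"
proof -
  \<comment> \<open>The inverse is taken blockwise: that of the (t, r)-block has rows (0, 1) and (1,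
    2 h), and the fibre entries are inverted.\<close>
  let ?A = "vector [vector [0, 1, 0, 0], vector [1, 2 * h, 0, 0], vector [0, 0, 1 / k, 0],
    vector [0, 0, 0, 1 / k]] :: real^4^4"
  have "(base_form h + fibre_form k) ** ?A = mat 1" "?A ** (base_form h + fibre_form k) = mat 1"
    using assms by (simp_all add: base_form_def fibre_form_def matrix_matrix_mult_def mat_def
        vec_eq_iff forall_4 sum_4)
  then show ?thesis unfolding invertible_def by blast
qed

text \<open>\<open>K\<close>, \<open>L\<close> and \<open>N\<close> are (up to sign) the curvatures of the \<open>(t, r)\<close>-planes, the mixed planes and
  the \<open>(x\<^sup>3, x\<^sup>4)\<close>-planes; \<open>mat 1\<close> splits into \<open>base_proj\<close> and \<open>fibre_form 1\<close>.\<close>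

definition base_proj :: "real^4^4" where
  "base_proj = vector [vector [1, 0, 0, 0], vector [0, 1, 0, 0], 0, 0]"

definition warped_curvature ::
  "real \<Rightarrow> real \<Rightarrow> real \<Rightarrow> real^4^4 \<Rightarrow> real^4^4 \<Rightarrow> 4 \<Rightarrow> 4 \<Rightarrow> 4 \<Rightarrow> 4 \<Rightarrow> real" where
  "warped_curvature K L N B F i j l k =
     (K * B $ i $ l + L * F $ i $ l) * base_proj $ j $ k - (K * B $ j $ l + L * F $ j $ l) * base_proj $ i $ k
     + (L * B $ i $ l + N * F $ i $ l) * fibre_form 1 $ j $ k - (L * B $ j $ l + N * F $ j $ l) * fibre_form 1 $ i $ k"

text \<open>A finite check over all indices. Here \<open>k33\<close>, \<open>k34\<close>,
  \<open>k44\<close> stand for the second derivatives of log f; sharing \<open>k34\<close> records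
  their symmetry. In the last coefficient 2 h is the squared gradient of r, and
  \<open>w\<^sup>2 * (k33 + k44)\<close> stands for the Gauss curvature of the fibre metric with
  conformal factor 1 / f^2.\<close>

lemma christoffel_table_curvature:
  assumes "r \<noteq> 0" "w \<noteq> 0"
    and \<Gamma>: "\<Gamma> = christoffel_table h' (2 * h * h') (1 / r) (r / w\<^sup>2) (2 * h * r / w\<^sup>2) (w3 / w) (w4 / w)"
    and d\<Gamma>1: "d\<Gamma> 1 = 0"
    and d\<Gamma>2: "d\<Gamma> 2 = christoffel_table h'' (2 * (h'\<^sup>2 + h * h'')) (- (1 / r\<^sup>2)) (1 / w\<^sup>2) (2 * (h' * r + h) / w\<^sup>2) 0 0"
    and d\<Gamma>3: "d\<Gamma> 3 = christoffel_table 0 0 0 (- (2 * r * w3 / w ^ 3)) (- (4 * h * r * w3 / w ^ 3)) k33 k34"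
    and d\<Gamma>4: "d\<Gamma> 4 = christoffel_table 0 0 0 (- (2 * r * w4 / w ^ 3)) (- (4 * h * r * w4 / w ^ 3)) k34 k44"
  shows "d\<Gamma> j $ i $ l $ k - d\<Gamma> i $ j $ l $ k + (\<Sum>m\<in>UNIV. \<Gamma> $ i $ l $ m * \<Gamma> $ j $ m $ k - \<Gamma> $ j $ l $ m * \<Gamma> $ i $ m $ k)
    = warped_curvature (- h'') (- (h' / r)) (- ((2 * h + w\<^sup>2 * (k33 + k44)) / r\<^sup>2))
        (base_form h) (fibre_form (- (r\<^sup>2 / w\<^sup>2))) i j l k"
proof -
  note defs = \<Gamma> d\<Gamma>1 d\<Gamma>2 d\<Gamma>3 d\<Gamma>4 christoffel_table_def warped_curvature_def base_form_def fibre_form_def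
    base_proj_def sum_4
  show ?thesis
    using exhaust_4[of i] exhaust_4[of j] exhaust_4[of k] exhaust_4[of l] assms(1,2)
    by (elim disjE; simp add: defs)
     (simp_all add: field_simps power2_eq_square power3_eq_cube)
qed

text \<open>The common shape of the derivatives of the metric: the first parameter is the derivative
  of h, the second that of the fibre coefficient.\<close>

definition metric_deriv_table :: "real \<Rightarrow> real \<Rightarrow> real^4^4" where
  "metric_deriv_table \<eta> \<kappa> = vector [vector [- 2 * \<eta>, 0, 0, 0], 0, vector [0, 0, \<kappa>, 0], vector [0, 0, 0, \<kappa>]]"

lemma koszul_solution:
  assumes "r \<noteq> 0" "w \<noteq> 0"
    and koszul: "\<And>k. 2 * (\<Sum>m\<in>UNIV. v $ m * (base_form h + fibre_form (- (r\<^sup>2 / w\<^sup>2))) $ m $ k) =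
      dg i $ j $ k + dg j $ i $ k - dg k $ i $ j"
    and dg: "dg 1 = 0" "dg 2 = metric_deriv_table h' (- (2 * r / w\<^sup>2))"
      "dg 3 = metric_deriv_table 0 (2 * r\<^sup>2 * w3 / w ^ 3)" "dg 4 = metric_deriv_table 0 (2 * r\<^sup>2 * w4 / w ^ 3)"
  shows "v = christoffel_table h' (2 * h * h') (1 / r) (r / w\<^sup>2) (2 * h * r / w\<^sup>2) (w3 / w) (w4 / w) $ i $ j"
proof -
  let ?\<kappa> = "\<lambda>k. dg i $ j $ k + dg j $ i $ k - dg k $ i $ j"
  \<comment> \<open>Solving the Koszul equations: index 2 isolates the first component, index 1 then
    gives the second one, and indices 3 and 4 are decoupled.\<close>
  have "v $ 1 = ?\<kappa> 2 / 2" "v $ 2 = ?\<kappa> 1 / 2 + h * ?\<kappa> 2"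
    "v $ 3 = - (w\<^sup>2 / (2 * r\<^sup>2) * ?\<kappa> 3)" "v $ 4 = - (w\<^sup>2 / (2 * r\<^sup>2) * ?\<kappa> 4)"
    using assms(1,2) by (simp_all add: koszul[symmetric] sum_4 base_form_def fibre_form_def field_simps)
  then show ?thesis
    using exhaust_4[of i] exhaust_4[of j] assms(1,2)
    by (elim disjE; simp add: dg metric_deriv_table_def christoffel_table_def vec_eq_iff forall_4)
      (simp_all add: field_simps power2_eq_square power3_eq_cube)
qed

lemma pderiv_at_christoffel_table:
  assumes "u differentiable (at x)" "v differentiable (at x)" "s differentiable (at x)"
    "m differentiable (at x)" "n differentiable (at x)" "k3 differentiable (at x)" "k4 differentiable (at x)"
  shows "pderiv_at d (\<lambda>y. christoffel_table (u y) (v y) (s y) (m y) (n y) (k3 y) (k4 y) $ i $ j $ k) x =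
    christoffel_table (pderiv_at d u x) (pderiv_at d v x) (pderiv_at d s x) (pderiv_at d m x)
      (pderiv_at d n x) (pderiv_at d k3 x) (pderiv_at d k4 x) $ i $ j $ k"
  using exhaust_4[of i] exhaust_4[of j] exhaust_4[of k]
  by (elim disjE; simp add: christoffel_table_def pderiv_at_minus assms)

lemma rt_h_has_derivative:
  assumes "r \<noteq> 0"
  shows "(rt_h a b q has_field_derivative rt_h' b q r) (at r)"
    and "(rt_h' b q has_field_derivative - (2 * q / r ^ 3)) (at r)"
  unfolding rt_h_def [abs_def] rt_h'_def [abs_def] using assms
  by (auto intro!: derivative_eq_intros simp: field_simps power2_eq_square power3_eq_cube)

section \<open>Christoffel symbols and curvature of the metric\<close>

context
  fixes a b q :: real and f :: "real^2 \<Rightarrow> real" and M :: "(real^4) set"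
  assumes M: "open M"
    and r_nz: "\<And>x. x \<in> M \<Longrightarrow> x $ 2 \<noteq> 0"
    and f_smooth: "smooth_fun (x34 ` M) f"
    and f_nz: "\<And>y. y \<in> x34 ` M \<Longrightarrow> f y \<noteq> 0"
begin

lemma differentiable_f: "x \<in> M \<Longrightarrow> (\<lambda>y. f (x34 y)) differentiable (at x)"
  by (rule smooth_fun_differentiable[OF smooth_fun_x34[OF M f_smooth] M])

lemma differentiable_pderiv_f: "x \<in> M \<Longrightarrow> (\<lambda>y. pderiv_at i f (x34 y)) differentiable (at x)"
  by (rule smooth_fun_differentiable[OF smooth_fun_x34[OF M smooth_fun_pderiv_at[OF f_smooth]] M])

text \<open>Symmetry of second derivatives is applied on M to the pullback of f, whose directions 3
  and 4 are the directions 1 and 2 of the plane.\<close>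

lemma pderiv_pderiv_f_commute:
  assumes "x \<in> M"
  shows "pderiv_at 4 (\<lambda>y. pderiv_at 1 f (x34 y)) x = pderiv_at 3 (\<lambda>y. pderiv_at 2 f (x34 y)) x"
  using pderiv_at_commute[OF M smooth_fun_x34[OF M f_smooth] assms, of 4 3]
  by (simp add: pderiv_at_x34[of _ f])

lemma pderiv_at_robinson_trautman:
  assumes x: "x \<in> M"
  shows "pderiv_at d (\<lambda>y. robinson_trautman a b q f y $ i $ j) x = metric_deriv_table
    (rt_h' b q (x $ 2) * (if d = 2 then 1 else 0))
    (- (2 * x $ 2 * (if d = 2 then 1 else 0) / (f (x34 x))\<^sup>2)
       + 2 * (x $ 2)\<^sup>2 * pderiv_at d (\<lambda>y. f (x34 y)) x / f (x34 x) ^ 3) $ i $ j"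
proof -
  have nz: "x $ 2 \<noteq> 0" "f (x34 x) \<noteq> 0"
    using r_nz f_nz x by auto
  note df = differentiable_f[OF x]
  note h = pderiv_at_compose[where \<phi>="\<lambda>y. y $ 2" and x=x, OF rt_h_has_derivative(1)[OF nz(1)] differentiable_coord]
  have 1: "pderiv_at d (\<lambda>y. - (2 * rt_h a b q (y $ 2))) x = - (2 * (rt_h' b q (x $ 2) * (if d = 2 then 1 else 0)))"
    by (simp add: pderiv_at_minus pderiv_at_mult h pderiv_at_coord)
  have 2: "pderiv_at d (\<lambda>y. - ((y $ 2)\<^sup>2 / (f (x34 y))\<^sup>2)) x =
     - (2 * x $ 2 * (if d = 2 then 1 else 0) / (f (x34 x))\<^sup>2)
       + 2 * (x $ 2)\<^sup>2 * pderiv_at d (\<lambda>y. f (x34 y)) x / f (x34 x) ^ 3"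
    using nz df
    by (simp add: pderiv_at_minus pderiv_at_divide_square differentiable_coord)
      (simp add: power2_eq_square pderiv_at_mult differentiable_coord pderiv_at_coord)
  show ?thesis
    using exhaust_4[of i] exhaust_4[of j]
    by (elim disjE) (simp_all add: robinson_trautman_split base_form_def fibre_form_def metric_deriv_table_def 1 2)
qed

text \<open>One formula serves all four directions: \<open>\<delta>\<close> is the derivative of r,
  nonzero only for d = 2, and \<open>wd\<close> is that of f, which vanishes for d = 1 and d =
  2.\<close>

lemma pderiv_at_rt_christoffel:
  assumes x: "x \<in> M"
  defines "r \<equiv> x $ 2" and "w \<equiv> f (x34 x)" and "h \<equiv> rt_h a b q (x $ 2)" and "h' \<equiv> rt_h' b q (x $ 2)"
    and "h'' \<equiv> - (2 * q / (x $ 2) ^ 3)"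
  shows "pderiv_at d (\<lambda>y. christoffel_table (rt_h' b q (y $ 2)) (2 * rt_h a b q (y $ 2) * rt_h' b q (y $ 2))
       (1 / y $ 2) (y $ 2 / (f (x34 y))\<^sup>2) (2 * rt_h a b q (y $ 2) * y $ 2 / (f (x34 y))\<^sup>2)
       (pderiv_at 1 f (x34 y) / f (x34 y)) (pderiv_at 2 f (x34 y) / f (x34 y)) $ i $ j $ k) x =
     (let \<delta> = (if d = 2 then 1 else 0); wd = pderiv_at d (\<lambda>y. f (x34 y)) x in
      christoffel_table (h'' * \<delta>) (2 * (h'\<^sup>2 + h * h'') * \<delta>) (- (\<delta> / r\<^sup>2)) (\<delta> / w\<^sup>2 - 2 * r * wd / w ^ 3)
        (2 * (h' * r + h) * \<delta> / w\<^sup>2 - 4 * h * r * wd / w ^ 3)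
        (pderiv_at d (\<lambda>y. pderiv_at 1 f (x34 y)) x / w - pderiv_at 1 f (x34 x) * wd / w\<^sup>2)
        (pderiv_at d (\<lambda>y. pderiv_at 2 f (x34 y)) x / w - pderiv_at 2 f (x34 x) * wd / w\<^sup>2) $ i $ j $ k)"
proof -
  have nz: "x $ 2 \<noteq> 0" "f (x34 x) \<noteq> 0"
    using r_nz f_nz x by auto
  note df = differentiable_f[OF x] and df' = differentiable_pderiv_f[OF x]
  note h = pderiv_at_compose[where \<phi>="\<lambda>y. y $ 2" and x=x, OF rt_h_has_derivative(1)[OF nz(1)] differentiable_coord]
  note h' = pderiv_at_compose[where \<phi>="\<lambda>y. y $ 2" and x=x, OF rt_h_has_derivative(2)[OF nz(1)] differentiable_coord]
  note diffs = differentiable_coord df df' h h' differentiable_mult differentiable_divide differentiable_power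
  have v: "pderiv_at d (\<lambda>y. 2 * rt_h a b q (y $ 2) * rt_h' b q (y $ 2)) x = 2 * (h'\<^sup>2 + h * h'') * (if d = 2 then 1 else 0)"
    by (simp add: pderiv_at_mult diffs pderiv_at_coord h_def h'_def h''_def power2_eq_square)
  have s: "pderiv_at d (\<lambda>y. 1 / y $ 2) x = - ((if d = 2 then 1 else 0) / r\<^sup>2)"
    using nz by (simp add: pderiv_at_divide diffs pderiv_at_coord r_def)
  have m: "pderiv_at d (\<lambda>y. y $ 2 / (f (x34 y))\<^sup>2) x =
      (if d = 2 then 1 else 0) / w\<^sup>2 - 2 * r * pderiv_at d (\<lambda>y. f (x34 y)) x / w ^ 3"
    using nz by (simp add: pderiv_at_divide_square diffs pderiv_at_coord r_def w_def)
  have n: "pderiv_at d (\<lambda>y. 2 * rt_h a b q (y $ 2) * y $ 2 / (f (x34 y))\<^sup>2) x =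
      2 * (h' * r + h) * (if d = 2 then 1 else 0) / w\<^sup>2 - 4 * h * r * pderiv_at d (\<lambda>y. f (x34 y)) x / w ^ 3"
    using nz
    by (simp add: pderiv_at_divide_square pderiv_at_mult diffs pderiv_at_coord r_def w_def h_def h'_def distrib_left)
      (simp add: mult.assoc)
  have k: "pderiv_at d (\<lambda>y. pderiv_at i f (x34 y) / f (x34 y)) x =
      pderiv_at d (\<lambda>y. pderiv_at i f (x34 y)) x / w - pderiv_at i f (x34 x) * pderiv_at d (\<lambda>y. f (x34 y)) x / w\<^sup>2" for i
    using nz by (simp add: pderiv_at_divide diffs w_def)
  have u: "pderiv_at d (\<lambda>y. rt_h' b q (y $ 2)) x = h'' * (if d = 2 then 1 else 0)"
    by (simp add: h' pderiv_at_coord h''_def)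
  show ?thesis
    unfolding Let_def u[symmetric] v[symmetric] s[symmetric] m[symmetric] n[symmetric] k[symmetric]
    by (rule pderiv_at_christoffel_table) (use nz in \<open>simp_all add: diffs\<close>)
qed

context
  fixes D :: "4 connection"
  assumes lc: "levi_civita M (robinson_trautman a b q f) D"
begin

lemma connection_christoffel_table:
  assumes x: "x \<in> M"
  shows "D (coord_vfield i) (coord_vfield j) x =
    christoffel_table (rt_h' b q (x $ 2)) (2 * rt_h a b q (x $ 2) * rt_h' b q (x $ 2))
       (1 / x $ 2) (x $ 2 / (f (x34 x))\<^sup>2) (2 * rt_h a b q (x $ 2) * x $ 2 / (f (x34 x))\<^sup>2)
       (pderiv_at 1 f (x34 x) / f (x34 x)) (pderiv_at 2 f (x34 x) / f (x34 x)) $ i $ j"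
proof (rule koszul_solution)
  show "x $ 2 \<noteq> 0" "f (x34 x) \<noteq> 0"
    using r_nz f_nz x by auto
  let ?dg = "\<lambda>d. \<chi> i j. pderiv_at d (\<lambda>y. robinson_trautman a b q f y $ i $ j) x"
  have sym: "robinson_trautman a b q f y $ i $ j = robinson_trautman a b q f y $ j $ i" for y i j
    unfolding robinson_trautman_split by (rule form_symmetric)
  show "2 * (\<Sum>m\<in>UNIV. D (coord_vfield i) (coord_vfield j) x $ m *
        (base_form (rt_h a b q (x $ 2)) + fibre_form (- ((x $ 2)\<^sup>2 / (f (x34 x))\<^sup>2))) $ m $ k) =
      ?dg i $ j $ k + ?dg j $ i $ k - ?dg k $ i $ j" for k
    using koszul_coord[OF lc x sym, of i j k] by (simp add: robinson_trautman_split)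
qed (simp_all add: pderiv_at_robinson_trautman[OF x] pderiv_at_x34[of _ f] vec_eq_iff,
    simp_all add: metric_deriv_table_def forall_4)

text \<open>The coefficient N, which contains the second derivatives of f, is left abstract because
  it will cancel in R . T.\<close>

lemma curvature_op_rt:
  assumes x: "x \<in> M"
  obtains N where "\<And>i j l k. curvature_op D (coord_vfield i) (coord_vfield j) (coord_vfield l) x $ k =
    warped_curvature (2 * q / (x $ 2) ^ 3) (- (rt_h' b q (x $ 2) / x $ 2)) N
      (base_form (rt_h a b q (x $ 2))) (fibre_form (- ((x $ 2)\<^sup>2 / (f (x34 x))\<^sup>2))) i j l k"
proof -
  have nz: "x $ 2 \<noteq> 0" "f (x34 x) \<noteq> 0"
    using r_nz f_nz x by auto
  have D: "affine_connection M D"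
    using lc by (simp add: levi_civita_def)
  let ?d\<Gamma> = "\<lambda>d. \<chi> i j k. pderiv_at d (\<lambda>y. D (coord_vfield i) (coord_vfield j) y $ k) x"
  \<comment> \<open>The table describes the symbols at every point of the open set M, so it may be
    differentiated.\<close>
  have d\<Gamma>: "pderiv_at d (\<lambda>y. D (coord_vfield i) (coord_vfield j) y $ k) x =
    pderiv_at d (\<lambda>y. christoffel_table (rt_h' b q (y $ 2)) (2 * rt_h a b q (y $ 2) * rt_h' b q (y $ 2))
       (1 / y $ 2) (y $ 2 / (f (x34 y))\<^sup>2) (2 * rt_h a b q (y $ 2) * y $ 2 / (f (x34 y))\<^sup>2)
       (pderiv_at 1 f (x34 y) / f (x34 y)) (pderiv_at 2 f (x34 y) / f (x34 y)) $ i $ j $ k) x" for d i j k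
    by (rule pderiv_at_cong[OF M x]) (simp add: connection_christoffel_table)
  note d\<Gamma>' = d\<Gamma>[unfolded pderiv_at_rt_christoffel[OF x] Let_def pderiv_at_x34[of _ f]]
  let ?w = "\<lambda>i d. pderiv_at d (\<lambda>y. pderiv_at i f (x34 y)) x"
  let ?f = "f (x34 x)" and ?f3 = "pderiv_at 1 f (x34 x)" and ?f4 = "pderiv_at 2 f (x34 x)"
  have w12: "?w i 1 = 0" "?w i 2 = 0" for i
    by (simp_all add: pderiv_at_x34)
  define k33 where "k33 = ?w 1 3 / ?f - ?f3 * ?f3 / ?f\<^sup>2"
  define k34 where "k34 = ?w 2 3 / ?f - ?f4 * ?f3 / ?f\<^sup>2"
  define k44 where "k44 = ?w 2 4 / ?f - ?f4 * ?f4 / ?f\<^sup>2"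
  \<comment> \<open>The two mixed derivatives of log f become one parameter.\<close>
  have k34': "?w 1 4 / ?f - ?f3 * ?f4 / ?f\<^sup>2 = k34"
    by (simp add: k34_def pderiv_pderiv_f_commute[OF x] mult.commute)
  have table_0: "christoffel_table 0 0 0 0 0 0 0 = 0"
    by (simp add: christoffel_table_def vec_eq_iff forall_4)
  have d1: "?d\<Gamma> 1 = 0"
    by (simp add: d\<Gamma>' vec_eq_iff w12 table_0)
  have d2: "?d\<Gamma> 2 = christoffel_table (- (2 * q / x $ 2 ^ 3))
      (2 * ((rt_h' b q (x $ 2))\<^sup>2 + rt_h a b q (x $ 2) * - (2 * q / x $ 2 ^ 3))) (- (1 / (x $ 2)\<^sup>2)) (1 / ?f\<^sup>2)
      (2 * (rt_h' b q (x $ 2) * x $ 2 + rt_h a b q (x $ 2)) / ?f\<^sup>2) 0 0"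
    by (simp add: d\<Gamma>' vec_eq_iff w12)
  have d3: "?d\<Gamma> 3 = christoffel_table 0 0 0 (- (2 * x $ 2 * ?f3 / ?f ^ 3))
      (- (4 * rt_h a b q (x $ 2) * x $ 2 * ?f3 / ?f ^ 3)) k33 k34"
    by (simp add: d\<Gamma>' vec_eq_iff k33_def k34_def)
  have d4: "?d\<Gamma> 4 = christoffel_table 0 0 0 (- (2 * x $ 2 * ?f4 / ?f ^ 3))
      (- (4 * rt_h a b q (x $ 2) * x $ 2 * ?f4 / ?f ^ 3)) k34 k44"
    by (simp add: d\<Gamma>' vec_eq_iff k34' k44_def)
  show thesis
    by (rule that)
      (use christoffel_table_curvature[OF nz refl d1 d2 d3 d4]
        in \<open>simp add: curvature_op_christoffel[OF M D x] connection_christoffel_table[OF x]\<close>)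
qed

end

end


subsection \<open>Warped curvature tensors\<close>

text \<open>Each of the two projections has trace 2, and contracting a block with its own projection
  returns the block, with the other one gives zero.\<close>

lemma warped_curvature_trace:
  "(\<Sum>i\<in>UNIV. warped_curvature K L N (base_form h) (fibre_form \<kappa>) i j k i) =
    (- (K + 2 * L) *\<^sub>R base_form h + - (2 * L + N) *\<^sub>R fibre_form \<kappa>) $ j $ k"
  using exhaust_4[of j] exhaust_4[of k]
  by (elim disjE; simp add: warped_curvature_def base_form_def fibre_form_def base_proj_def sum_4 algebra_simps)

text \<open>The pointwise form of \<open>eval02\<close>: once the curvature is tensorial, the rest
  is linear algebra in one tangent space.\<close>

definition bform :: "real^4^4 \<Rightarrow> real^4 \<Rightarrow> real^4 \<Rightarrow> real" where
  "bform H u v = (\<Sum>i\<in>UNIV. \<Sum>j\<in>UNIV. H $ i $ j * u $ i * v $ j)"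

lemma eval02_bform: "eval02 H X Y x = bform (H x) (X x) (Y x)"
  by (simp add: eval02_def bform_def)

lemma bform_linear:
  "bform H (u + u') v = bform H u v + bform H u' v"
  "bform H (u - u') v = bform H u v - bform H u' v"
  "bform H (c *\<^sub>R u) v = c * bform H u v"
  "bform (H + H') u v = bform H u v + bform H' u v"
  "bform (c *\<^sub>R H) u v = c * bform H u v"
  by (simp_all add: bform_def sum_4 algebra_simps)

text \<open>Each block ignores the components along the other plane. Thus the base part of R reaches
  only the B-part of T, and the fibre part only its F-part.\<close>

lemma bform_base_proj:
  "bform (base_form h) (base_proj *v u) v = bform (base_form h) u v"
  "bform (fibre_form \<kappa>) (base_proj *v u) v = 0"
  "bform (base_form h) (fibre_form 1 *v u) v = 0"
  "bform (fibre_form \<kappa>) (fibre_form 1 *v u) v = bform (fibre_form \<kappa>) u v"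
  by (simp_all add: bform_def sum_4 base_form_def fibre_form_def base_proj_def matrix_vector_mult_def)

lemma bform_commute:
  "bform (base_form h) u v = bform (base_form h) v u"
  "bform (fibre_form \<kappa>) u v = bform (fibre_form \<kappa>) v u"
  by (simp_all add: bform_def sum_4 base_form_def fibre_form_def)

text \<open>The triple sum factors because p involves one index only; the second formula is the
  first with u and v exchanged.\<close>

lemma sum_bform_mult:
  fixes u v z :: "real^4"
  shows "(\<Sum>i\<in>UNIV. \<Sum>j\<in>UNIV. \<Sum>l\<in>UNIV. u $ i * v $ j * z $ l * (A $ i $ l * p j)) = bform A u z * (\<Sum>j\<in>UNIV. p j * v $ j)"
    and "(\<Sum>i\<in>UNIV. \<Sum>j\<in>UNIV. \<Sum>l\<in>UNIV. u $ i * v $ j * z $ l * (A $ j $ l * p i)) = bform A v z * (\<Sum>j\<in>UNIV. p j * u $ j)"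
proof -
  show *: "(\<Sum>i\<in>UNIV. \<Sum>j\<in>UNIV. \<Sum>l\<in>UNIV. u $ i * v $ j * z $ l * (A $ i $ l * p j)) = bform A u z * (\<Sum>j\<in>UNIV. p j * v $ j)"
    for u v :: "real^4"
    unfolding bform_def sum_distrib_right sum_distrib_left
    by (subst sum.swap) (simp add: mult_ac)
  show "(\<Sum>i\<in>UNIV. \<Sum>j\<in>UNIV. \<Sum>l\<in>UNIV. u $ i * v $ j * z $ l * (A $ j $ l * p i)) = bform A v z * (\<Sum>j\<in>UNIV. p j * u $ j)"
    unfolding *[of v u, symmetric] by (subst sum.swap) (simp add: mult_ac)
qed

lemma warped_curvature_sum:
  fixes u v z :: "real^4"
  shows "(\<chi> k. \<Sum>i\<in>UNIV. \<Sum>j\<in>UNIV. \<Sum>l\<in>UNIV. u $ i * v $ j * z $ l * warped_curvature K L N B F i j l k) =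
    (K * bform B u z + L * bform F u z) *\<^sub>R (base_proj *v v) - (K * bform B v z + L * bform F v z) *\<^sub>R (base_proj *v u)
    + (L * bform B u z + N * bform F u z) *\<^sub>R (fibre_form 1 *v v) - (L * bform B v z + N * bform F v z) *\<^sub>R (fibre_form 1 *v u)"
proof -
  have P: "base_proj $ j $ k = base_proj $ k $ j" "fibre_form 1 $ j $ k = fibre_form 1 $ k $ j" for j k
    using exhaust_4[of j] exhaust_4[of k] by (elim disjE; simp add: base_proj_def fibre_form_def)+
  \<comment> \<open>Grouping the blocks into two forms gives every term the shape of
    \<open>sum_bform_mult\<close>; the transposed projections then read as matrix-vector
    products.\<close>
  have W: "warped_curvature K L N B F i j l k =
      (K *\<^sub>R B + L *\<^sub>R F) $ i $ l * base_proj $ k $ j - (K *\<^sub>R B + L *\<^sub>R F) $ j $ l * base_proj $ k $ i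
      + (L *\<^sub>R B + N *\<^sub>R F) $ i $ l * fibre_form 1 $ k $ j - (L *\<^sub>R B + N *\<^sub>R F) $ j $ l * fibre_form 1 $ k $ i" for i j l k
    by (simp add: warped_curvature_def P[of _ k])
  show ?thesis
    unfolding vec_eq_iff W right_diff_distrib distrib_left[of "_ * _ * _"] sum.distrib sum_subtractf sum_bform_mult bform_linear
    by (simp add: matrix_vector_mult_def)
qed

section \<open>Pseudosymmetry of the energy-momentum tensor\<close>

theorem theorem5p2:
  fixes a b q c G \<Lambda> :: real
    and f :: "real^2 \<Rightarrow> real"
    and M :: "(real^4) set"
    and D :: "4 connection"
  assumes "open M" and "connected M"
    and "\<And>x. x \<in> M \<Longrightarrow> x $ 2 \<noteq> 0"
    and "smooth_fun (x34 ` M) f"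
    and "\<And>y. y \<in> x34 ` M \<Longrightarrow> f y \<noteq> 0"
    and "c > 0" and "G > 0"
    and "levi_civita M (robinson_trautman a b q f) D"
  shows "\<forall>X1 X2 X Y. smooth_vfield M X1 \<longrightarrow> smooth_vfield M X2 \<longrightarrow>
           smooth_vfield M X \<longrightarrow> smooth_vfield M Y \<longrightarrow>
           (\<forall>x\<in>M. curvature_dot D (energy_momentum c G \<Lambda> (robinson_trautman a b q f) D) X1 X2 X Y x =
              (q - 2 * b * (x $ 2)\<^sup>2) / (x $ 2) ^ 3 *
              tachibana (robinson_trautman a b q f)
                (energy_momentum c G \<Lambda> (robinson_trautman a b q f) D) X1 X2 X Y x)"
proof (intro allI impI ballI)
  fix X1 X2 X Y x
  assume X1: "smooth_vfield M X1" and X2: "smooth_vfield M X2"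
    and X: "smooth_vfield M X" and Y: "smooth_vfield M Y" and x: "x \<in> M"
  let ?g = "robinson_trautman a b q f"
  let ?T = "energy_momentum c G \<Lambda> ?g D"
  define K where "K = 2 * q / (x $ 2) ^ 3"
  define L where "L = - (rt_h' b q (x $ 2) / x $ 2)"
  define B where "B = base_form (rt_h a b q (x $ 2))"
  define F where "F = fibre_form (- ((x $ 2)\<^sup>2 / (f (x34 x))\<^sup>2))"
  have nz: "x $ 2 \<noteq> 0" "f (x34 x) \<noteq> 0"
    using assms(3,5) x by auto
  obtain N where N: "\<And>i j l k. curvature_op D (coord_vfield i) (coord_vfield j) (coord_vfield l) x $ k =
    warped_curvature K L N B F i j l k"
    unfolding K_def L_def B_def F_def
    by (rule curvature_op_rt[OF assms(1) assms(3) assms(4) assms(5) assms(8) x]) auto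
  have g: "?g x = B + F"
    by (simp add: robinson_trautman_split B_def F_def)
  \<comment> \<open>Tensoriality extends the curvature formula from coordinate fields to all smooth
    fields.\<close>
  have R: "curvature_op D U V Z x =
    (K * bform B (U x) (Z x) + L * bform F (U x) (Z x)) *\<^sub>R (base_proj *v V x)
    - (K * bform B (V x) (Z x) + L * bform F (V x) (Z x)) *\<^sub>R (base_proj *v U x)
    + (L * bform B (U x) (Z x) + N * bform F (U x) (Z x)) *\<^sub>R (fibre_form 1 *v V x)
    - (L * bform B (V x) (Z x) + N * bform F (V x) (Z x)) *\<^sub>R (fibre_form 1 *v U x)"
    if "smooth_vfield M U" "smooth_vfield M V" "smooth_vfield M Z" for U V Z
  proof -
    have "affine_connection M D" "torsion_free M D"
      using assms(8) by (auto simp: levi_civita_def)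
    from curvature_op_tensorial[OF assms(1) this that x] show ?thesis
      unfolding warped_curvature_sum[symmetric] by (simp add: vec_eq_iff N)
  qed
  have "ricci ?g D x = - (K + 2 * L) *\<^sub>R B + - (2 * L + N) *\<^sub>R F"
  proof -
    have "ricci ?g D x $ j $ k = (\<Sum>i\<in>UNIV. warped_curvature K L N B F i j k i)" for j k
      unfolding N[symmetric]
      by (rule ricci_trace) (use nz in \<open>simp_all only: g B_def F_def, simp_all add: form_symmetric[simplified] form_invertible\<close>)
    then show ?thesis
      unfolding B_def F_def warped_curvature_trace by (simp add: vec_eq_iff)
  qed
  \<comment> \<open>The scalar curvature need not be evaluated: it multiplies g = B + F and so only
    shifts both coefficients.\<close>
  then have "?T x = (c ^ 4 / (8 * pi * G)) *\<^sub>R ((- (K + 2 * L) *\<^sub>R B + - (2 * L + N) *\<^sub>R F)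
      - (scalar_curvature ?g D x / 2 - \<Lambda>) *\<^sub>R (B + F))"
    by (simp add: energy_momentum_def g)
  also have "\<dots> = (c ^ 4 / (8 * pi * G) * (- (K + 2 * L) - (scalar_curvature ?g D x / 2 - \<Lambda>))) *\<^sub>R B
      + (c ^ 4 / (8 * pi * G) * (- (2 * L + N) - (scalar_curvature ?g D x / 2 - \<Lambda>))) *\<^sub>R F"
    by (simp only: scaleR_scaleR[symmetric] scaleR_diff_left scaleR_add_right scaleR_diff_right) simp
  finally obtain \<alpha> \<beta> where T: "?T x = \<alpha> *\<^sub>R B + \<beta> *\<^sub>R F"
    by blast
  \<comment> \<open>The factor of the theorem is h' / r.\<close>
  have L: "(q - 2 * b * (x $ 2)\<^sup>2) / (x $ 2) ^ 3 = - L"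
    using nz by (simp add: L_def rt_h'_def field_simps power2_eq_square power3_eq_cube)
  have proj: "bform B (base_proj *v u) v = bform B u v" "bform F (base_proj *v u) v = 0"
    "bform B (fibre_form 1 *v u) v = 0" "bform F (fibre_form 1 *v u) v = bform F u v" for u v
    by (simp_all add: B_def F_def bform_base_proj)
  have sym: "bform B u v = bform B v u" "bform F u v = bform F v u" for u v
    unfolding B_def F_def by (rule bform_commute)+
  \<comment> \<open>Moves the curvature operator to the first slot, where \<open>proj\<close>
    applies.\<close>
  have TR: "bform (?T x) u (curvature_op D U V Z x) = bform (?T x) (curvature_op D U V Z x) u" for u U V Z
    unfolding T bform_linear by (simp only: sym[of u "curvature_op D U V Z x"])
  \<comment> \<open>Terms with K or N cancel between the two summands of R . T by symmetry of B and
    F. In Q(g, T) the products of B with B and of F with F cancel likewise; the mixed products agree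
    up to the factor - L.\<close>
  show "curvature_dot D ?T X1 X2 X Y x = (q - 2 * b * (x $ 2)\<^sup>2) / (x $ 2) ^ 3 * tachibana ?g ?T X1 X2 X Y x"
    unfolding curvature_dot_def tachibana_def eval02_bform L TR
    unfolding R[OF X Y X1] R[OF X Y X2] T g bform_linear proj
    by (simp add: sym[of "X1 x" "X x"] sym[of "X1 x" "Y x"] algebra_simps)
qed

end
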